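(* Let $n\ge 3$ be an integer. There exist real numbers $l(n)$ and $u(n)$, depending only on $n$, such that for every real $\alpha\ge 0$ and all nonzero real masses $m_1,\dots,m_n\in\mathbb{R}\setminus\{0\}$ (of arbitrary signs) satisfying $\sum_{i=1}^n m_i\neq 0$, the number $N$ of non-degenerate central configurations of the planar $n$-body problem with masses $m_1,\dots,m_n$ and homogeneous potential $-U_\alpha$ (counted as equivalence classes, as specified in the context) satisfies $$ l(n)\;\le\; N\;\le\; u(n).$$ In particular, both bounds are independent of the exponent $\alpha$ and of the masses $m_1,\dots,m_n$.
   Context: Let $\Delta=\{(q_1,\dots,q_n)\in(\mathbb{R}^2)^n : q_i=q_j \text{ for some } i<j\}$ be the collision set, where $q_i\in\mathbb{R}^2$ is the position of the $i$-th body. For $\alpha\ge 0$ and masses $m_1,\dots,m_n$, define $U_\alpha:\mathbb{R}^{2n}\setminus\Delta\to\mathbb{R}$ by $$U_\alpha(q_1,\dots,q_n)=\sum_{1\le i<j\le n}\frac{m_im_j}{\|q_i-q_j\|^{\alpha}}\quad(\alpha>0),\qquad U_0(q_1,\dots,q_n)=-\sum_{1\le i<j\le n}m_im_j\log\|q_i-q_j\|,$$ where $\|\cdot\|$ is the Euclidean norm on $\mathbb{R}^2$. A central configuration is a configuration $\mathbf q=(q_1,\dots,q_n)\in\mathbb{R}^{2n}\setminus\Delta$ satisfying $-\nabla_iU_\alpha(\mathbf q)=\lambda m_i(q_i-c)$ for $1\le i\le n$, where $\nabla_i$ is the gradient with respect to $q_i$, $\lambda\in\mathbb{R}$, and $c=\sum_i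 m_iq_i/\sum_i m_i$ is the center of mass. Central configurations are normalised by $c=0$ (using translations) and $\lambda=1$ (using dilations). With $I(\mathbf q)=\sum_{i=1}^n m_i\|q_i\|^2$, the normalised central configurations are exactly the critical points on $\mathbb{R}^{2n}\setminus\Delta$ of the function $$F(\mathbf q)=U_\alpha(\mathbf q)+\tfrac12 I(\mathbf q).$$ This function is invariant under the diagonal action of the orthogonal group $O(2)$ on $(\mathbb{R}^2)^n$. Central configurations are counted as equivalence classes, i.e. as $O(2)$-orbits of normalised central configurations. A central configuration is non-degenerate if it is a non-degenerate critical point of $F$ modulo the rotational symmetry, i.e. if the kernel of the Hessian of $F$ at $\mathbf q$ is exactly the one-dimensional tangent space of the $SO(2)$-orbit of $\mathbf q$. *)

theory Defs
  imports "HOL-Analysis.Analysis"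
begin

text \<open>The bodies are indexed by a finite linearly ordered type \<open>'n\<close>, so that \<open>CARD('n)\<close> is the number
  of bodies and pairs \<open>i < j\<close> make sense; \<open>q $ i\<close> is the position of body \<open>i\<close>.\<close>

type_synonym 'n config = "real^2^'n"

definition collision_set :: "('n::{finite,linorder}) config set" where
  "collision_set = {q. \<exists>i j. i < j \<and> q $ i = q $ j}"

text \<open>Only the values off the collision set matter; on it, the value is an artefact of
  \<open>x / 0 = 0\<close> and \<open>ln 0 = 0\<close>.\<close>

definition potential :: "real \<Rightarrow> ('n::{finite,linorder} \<Rightarrow> real) \<Rightarrow> 'n config \<Rightarrow> real" where
  "potential \<alpha> m q =
     (if \<alpha> = 0
      then - (\<Sum>(i, j)\<in>{(i, j). i < j}. m i * m j * ln (norm (q $ i - q $ j)))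
      else (\<Sum>(i, j)\<in>{(i, j). i < j}. m i * m j / norm (q $ i - q $ j) powr \<alpha>))"

text \<open>Meaningful only where \<open>f\<close> is differentiable, which is the case for all uses below (points off
  the collision set, which is closed).\<close>

definition gradient :: "('a::real_inner \<Rightarrow> real) \<Rightarrow> 'a \<Rightarrow> 'a" where
  "gradient f x = (THE D. GDERIV f x :> D)"

text \<open>The Hessian as a linear endomorphism: the derivative of the gradient field.\<close>

definition hessian :: "('a::real_inner \<Rightarrow> real) \<Rightarrow> 'a \<Rightarrow> 'a \<Rightarrow> 'a" where
  "hessian f x = frechet_derivative (gradient f) (at x)"

definition partial_gradient ::
    "('n::finite) \<Rightarrow> ('n config \<Rightarrow> real) \<Rightarrow> 'n config \<Rightarrow> real^2" where
  "partial_gradient i f q = gradient (\<lambda>x. f (\<chi> j. if j = i then x else q $ j)) (q $ i)"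

definition center_of_mass :: "('n::finite \<Rightarrow> real) \<Rightarrow> 'n config \<Rightarrow> real^2" where
  "center_of_mass m q = (1 / (\<Sum>i\<in>UNIV. m i)) *\<^sub>R (\<Sum>i\<in>UNIV. m i *\<^sub>R q $ i)"

definition central_configuration ::
    "real \<Rightarrow> ('n::{finite,linorder} \<Rightarrow> real) \<Rightarrow> real \<Rightarrow> 'n config \<Rightarrow> bool" where
  "central_configuration \<alpha> m lam q \<longleftrightarrow>
     q \<notin> collision_set \<and>
     (\<forall>i. - partial_gradient i (potential \<alpha> m) q = (lam * m i) *\<^sub>R (q $ i - center_of_mass m q))"

definition normalised_cc ::
    "real \<Rightarrow> ('n::{finite,linorder} \<Rightarrow> real) \<Rightarrow> 'n config \<Rightarrow> bool" where
  "normalised_cc \<alpha> m q \<longleftrightarrow> central_configuration \<alpha> m 1 q \<and> center_of_mass m q = 0"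

definition moment_of_inertia :: "('n::finite \<Rightarrow> real) \<Rightarrow> 'n config \<Rightarrow> real" where
  "moment_of_inertia m q = (\<Sum>i\<in>UNIV. m i * (norm (q $ i))\<^sup>2)"

definition cc_fun :: "real \<Rightarrow> ('n::{finite,linorder} \<Rightarrow> real) \<Rightarrow> 'n config \<Rightarrow> real" where
  "cc_fun \<alpha> m q = potential \<alpha> m q + 1 / 2 * moment_of_inertia m q"

definition diag_act :: "real^2^2 \<Rightarrow> ('n::finite) config \<Rightarrow> 'n config" where
  "diag_act R q = (\<chi> i. R *v (q $ i))"

definition O2_orbit :: "('n::finite) config \<Rightarrow> 'n config set" where
  "O2_orbit q = {diag_act R q |R. orthogonal_matrix R}"

definition SO2_orbit :: "('n::finite) config \<Rightarrow> 'n config set" where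
  "SO2_orbit q = {diag_act R q |R. rotation_matrix R}"

text \<open>Velocities at \<open>x\<close> of curves in \<open>S\<close>; for an embedded submanifold \<open>S\<close> (such as an
  \<open>SO(2)\<close>-orbit) this is the usual tangent space.\<close>

definition tangent_space :: "'a::real_normed_vector set \<Rightarrow> 'a \<Rightarrow> 'a set" where
  "tangent_space S x =
     {v. \<exists>\<gamma> :: real \<Rightarrow> 'a. range \<gamma> \<subseteq> S \<and> \<gamma> 0 = x \<and> (\<gamma> has_vector_derivative v) (at 0)}"

text \<open>One-dimensionality of the tangent space is automatic: off the collision set at least one body
  (of two or more) is away from the origin.\<close>

definition nondegenerate ::
    "real \<Rightarrow> ('n::{finite,linorder} \<Rightarrow> real) \<Rightarrow> 'n config \<Rightarrow> bool" where
  "nondegenerate \<alpha> m q \<longleftrightarrow> {v. hessian (cc_fun \<alpha> m) q v = 0} = tangent_space (SO2_orbit q) q"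

definition nondegenerate_cc_classes ::
    "real \<Rightarrow> ('n::{finite,linorder} \<Rightarrow> real) \<Rightarrow> 'n config set set" where
  "nondegenerate_cc_classes \<alpha> m = O2_orbit ` {q. normalised_cc \<alpha> m q \<and> nondegenerate \<alpha> m q}"

end

theory Submission
  imports Defs
begin

text \<open>
  A central configuration solves a polynomial system in the coordinates of the bodies, the numbers
  \<open>L\<^bsub>ij\<^esub> = ln |q\<^sub>i - q\<^sub>j|\<^sup>2\<close> and \<open>W\<^bsub>ij\<^esub> = exp (\<beta> L\<^bsub>ij\<^esub>)\<close> with \<open>\<beta> = - (\<alpha> + 2) / 2\<close>; exponent and
  masses enter only through coefficients. By Khovanskii's method, the number of nondegenerate
  solutions of such a system is bounded in terms of its size and degree alone. The induction
  removes one exponential at a time: on the curve obtained by dropping an equation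
  \<open>P x * exp (- b * x\<^sub>v) = y\<close>, the left-hand side has a critical point between consecutive
  solutions, and the critical points are given by a Jacobian determinant, which is a polynomial up
  to an exponential factor. An equation \<open>|x|\<^sup>2 = R\<close>, with a slack variable, keeps all curves compact. To avoid
  the theory of curves, the critical points are replaced by points where the determinant has
  a small regular value, reached from the solutions by lifting a line through a local diffeomorphism.
\<close>

section \<open>Lifting lines through local homeomorphisms\<close>

text \<open>A nondegenerate central configuration is never an isolated critical point: its rotation
  circle comes with it, whereas the count for exponential systems sees only solutions with injective
  derivative. So a body \<open>k\<close> away from the origin is rotated onto the first axis, and
  the second component of its equation gives way to this condition. Nothing is lost: by rotation
  invariance, the derivative of that component at a solution is determined by the derivatives of the
  others. Which body serves depends on the configuration, hence the factor \<open>CARD('n)\<close>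
  in the final bound. A power of a distance enters as an exponential of a multiple of a logarithm,
  so the exponent becomes a mere rate, and the count is uniform in all rates. Each removed
  exponential doubles the constant, because the two signs of the Jacobian determinant are treated
  apart. The count is also uniform in the right-hand sides: this lets the Sard argument perturb them
  and lets \<open>R\<close> be fitted to any finite set of solutions, so that finiteness itself
  comes out at the end.\<close>

lemma local_inverse:
  fixes f :: "'a::euclidean_space \<Rightarrow> 'a"
  assumes der: "\<And>x. (f has_derivative f' x) (at x)"
    and cont: "\<And>h. continuous_on UNIV (\<lambda>x. f' x h)"
    and inj: "inj (f' a)"
  obtains U V g where "open U" "a \<in> U" "open V" "f a \<in> V" "homeomorphism U V f g"
proof -
  define F where "F x = Blinfun (f' x)" for x
  have bl: "bounded_linear (f' x)" for x using der has_derivative_bounded_linear by blast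
  have F: "blinfun_apply (F x) = f' x" for x
    unfolding F_def using bl by (simp add: bounded_linear_Blinfun_apply)
  obtain g where g: "linear g" "g \<circ> f' a = id"
    using linear_injective_left_inverse[of "f' a"] bl inj
    by (metis bounded_linear.linear)
  have "blinfun_apply (Blinfun g) = g"
    using g(1) by (simp add: bounded_linear_Blinfun_apply linear_conv_bounded_linear)
  then have inv: "Blinfun g o\<^sub>L F a = id_blinfun"
    using g(2) by (intro blinfun_eqI) (simp add: F fun_eq_iff)
  have "continuous_on UNIV F"
    by (rule continuous_on_blinfun_componentwise) (simp add: F cont)
  from inverse_function_theorem[OF open_UNIV _ this UNIV_I inv, of f] show thesis
    using that der F by metis
qed

text \<open>The set where two lifts agree is clopen in \<open>S\<close>: closed by continuity, open
  because near such a point both lifts stay in one neighbourhood on which \<open>\<Phi>\<close> is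
  injective.\<close>

lemma lift_unique:
  fixes \<gamma> \<gamma>' :: "'b::topological_space \<Rightarrow> 'a::real_normed_vector"
  assumes S: "connected S" and c: "continuous_on S \<gamma>" "continuous_on S \<gamma>'"
    and eq: "\<And>s. s \<in> S \<Longrightarrow> \<Phi> (\<gamma> s) = \<Phi> (\<gamma>' s)"
    and inj: "\<And>s. s \<in> S \<Longrightarrow> \<exists>U. open U \<and> \<gamma> s \<in> U \<and> inj_on \<Phi> U"
    and s0: "s0 \<in> S" "\<gamma> s0 = \<gamma>' s0" and s: "s \<in> S"
  shows "\<gamma> s = \<gamma>' s"
proof -
  let ?E = "{s \<in> S. \<gamma> s = \<gamma>' s}"
  have "closedin (top_of_set S) (S \<inter> (\<lambda>s. \<gamma> s - \<gamma>' s) -` {0})"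
    by (intro continuous_closedin_preimage continuous_intros c)
  moreover have "S \<inter> (\<lambda>s. \<gamma> s - \<gamma>' s) -` {0} = ?E" by auto
  ultimately have cl: "closedin (top_of_set S) ?E" by simp
  have "openin (top_of_set S) ?E"
  proof (subst openin_subopen, intro ballI)
    fix t assume t: "t \<in> ?E"
    then obtain U where U: "open U" "\<gamma> t \<in> U" "inj_on \<Phi> U" using inj by blast
    let ?T = "(S \<inter> \<gamma> -` U) \<inter> (S \<inter> \<gamma>' -` U)"
    have "openin (top_of_set S) ?T"
      using U(1) c by (intro openin_Int continuous_openin_preimage_gen)
    moreover have "?T \<subseteq> ?E" using U(3) eq by (auto dest: inj_onD)
    moreover have "t \<in> ?T" using t U(2) by auto
    ultimately show "\<exists>T. openin (top_of_set S) T \<and> t \<in> T \<and> T \<subseteq> ?E" by blast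
  qed
  with cl S have "?E = {} \<or> ?E = S" unfolding connected_clopen by blast
  with s0 s show ?thesis by auto
qed

text \<open>A Lebesgue number argument. One radius \<open>r\<close> for all points of
  \<open>K\<close> means that a lift over \<open>K\<close> can always be prolonged by a fixed
  length.\<close>

lemma uniform_local_section:
  fixes \<Phi> :: "'a::metric_space \<Rightarrow> 'b::metric_space"
  assumes K: "compact K" and cont: "continuous_on UNIV \<Phi>"
    and loc: "\<And>x. x \<in> K \<Longrightarrow> \<exists>U V g. open U \<and> x \<in> U \<and> open V \<and> \<Phi> x \<in> V \<and> homeomorphism U V \<Phi> g"
  shows "\<exists>r>0. \<forall>x\<in>K. \<exists>g. continuous_on (ball (\<Phi> x) r) g \<and> (\<forall>z\<in>ball (\<Phi> x) r. \<Phi> (g z) = z) \<and> g (\<Phi> x) = x"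
proof -
  let ?P = "\<lambda>x r. \<exists>g. continuous_on (ball (\<Phi> x) r) g \<and> (\<forall>z\<in>ball (\<Phi> x) r. \<Phi> (g z) = z) \<and> g (\<Phi> x) = x"
  have "\<exists>W r. open W \<and> x \<in> W \<and> r > 0 \<and> (\<forall>x'\<in>W. ?P x' r)" if x: "x \<in> K" for x
  proof -
    obtain U V g where *: "open U" "x \<in> U" "open V" "\<Phi> x \<in> V" "homeomorphism U V \<Phi> g"
      using loc[OF x] by blast
    then obtain r where r: "r > 0" "ball (\<Phi> x) r \<subseteq> V" using open_contains_ball by blast
    \<comment> \<open>Halving the radius keeps the ball around \<open>\<Phi> x'\<close> inside
      \<open>V\<close> for every \<open>x'\<close> in this neighbourhood, so one inverse
      \<open>g\<close> serves them all.\<close>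
    let ?W = "U \<inter> \<Phi> -` ball (\<Phi> x) (r/2)"
    have "open ?W" using * cont by (intro open_Int) (auto intro: open_vimage)
    moreover have "?P x' (r/2)" if x': "x' \<in> ?W" for x'
    proof (intro exI conjI ballI)
      have sub: "ball (\<Phi> x') (r/2) \<subseteq> V"
      proof (intro order_trans[OF _ r(2)] subsetI)
        fix z assume "z \<in> ball (\<Phi> x') (r/2)"
        then show "z \<in> ball (\<Phi> x) r"
          using x' dist_triangle[of "\<Phi> x" z "\<Phi> x'"] by auto
      qed
      then show "continuous_on (ball (\<Phi> x') (r/2)) g"
        using *(5) by (meson continuous_on_subset homeomorphism_cont2)
      show "\<Phi> (g z) = z" if "z \<in> ball (\<Phi> x') (r/2)" for z
        using that sub *(5) by (meson homeomorphism_apply2 subsetD)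
      show "g (\<Phi> x') = x'" using x' *(5) by (meson IntD1 homeomorphism_apply1)
    qed
    moreover have "x \<in> ?W" using * r by auto
    ultimately show ?thesis using r(1) by (metis half_gt_zero)
  qed
  then obtain W r where W: "\<And>x. x \<in> K \<Longrightarrow> open (W x) \<and> x \<in> W x \<and> r x > 0 \<and> (\<forall>x'\<in>W x. ?P x' (r x))"
    by metis
  obtain D where D: "D \<subseteq> K" "finite D" "K \<subseteq> (\<Union>x\<in>D. W x)"
    using compactE_image[OF K, of K W] W by blast
  define \<rho> where "\<rho> = Min (insert 1 (r ` D))"
  have "\<rho> > 0" unfolding \<rho>_def using D W by (subst Min_gr_iff) auto
  moreover have "?P x \<rho>" if x: "x \<in> K" for x
  proof -
    obtain d where d: "d \<in> D" "x \<in> W d" using D x by blast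
    then obtain g where g: "continuous_on (ball (\<Phi> x) (r d)) g"
      "\<forall>z\<in>ball (\<Phi> x) (r d). \<Phi> (g z) = z" "g (\<Phi> x) = x" using W D by (metis subsetD)
    have "\<rho> \<le> r d" unfolding \<rho>_def using D(2) d by (intro Min_le) auto
    then have "ball (\<Phi> x) \<rho> \<subseteq> ball (\<Phi> x) (r d)" by auto
    then show ?thesis using g continuous_on_subset by blast
  qed
  ultimately show ?thesis by blast
qed

text \<open>A line can be lifted through \<open>\<Phi>\<close> as long as \<open>\<Phi>\<close> is a local homeomorphism along the lift. The
  preimage of the line being bounded, the lift must leave the region \<open>\<delta> \<le> J\<close>.\<close>

lemma lift_until_level:
  fixes \<Phi> :: "'a::euclidean_space \<Rightarrow> 'a" and J :: "'a \<Rightarrow> real"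
  assumes cont: "continuous_on UNIV \<Phi>" "continuous_on UNIV J"
    and loc: "\<And>x. J x \<ge> \<delta> \<Longrightarrow> \<exists>U V g. open U \<and> x \<in> U \<and> open V \<and> \<Phi> x \<in> V \<and> homeomorphism U V \<Phi> g"
    and bdd: "bounded {x. \<exists>s. \<Phi> x = y + s *\<^sub>R e}" and e: "norm e = 1"
    and a: "\<Phi> a = y" "J a > \<delta>"
  obtains c \<gamma> where "0 \<le> c" "continuous_on {0..c} \<gamma>" "\<gamma> 0 = a"
    "\<And>s. s \<in> {0..c} \<Longrightarrow> \<Phi> (\<gamma> s) = y + s *\<^sub>R e \<and> J (\<gamma> s) \<ge> \<delta>" "J (\<gamma> c) = \<delta>"
proof -
  let ?L = "{x. \<exists>s. \<Phi> x = y + s *\<^sub>R e}"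
  let ?K = "closure ?L \<inter> J -` {\<delta>..}"
  have K: "compact ?K"
    using bdd cont(2) by (intro compact_Int_closed closed_vimage) (simp_all add: compact_closure)
  have K_loc: "\<exists>U V g. open U \<and> x \<in> U \<and> open V \<and> \<Phi> x \<in> V \<and> homeomorphism U V \<Phi> g" if "x \<in> ?K" for x
    using that by (intro loc) simp
  obtain r where r: "r > 0"
    "\<And>x. x \<in> ?K \<Longrightarrow> \<exists>g. continuous_on (ball (\<Phi> x) r) g \<and> (\<forall>z\<in>ball (\<Phi> x) r. \<Phi> (g z) = z) \<and> g (\<Phi> x) = x"
    using uniform_local_section[OF K cont(1) K_loc] by blast
  define good where "good c \<gamma> \<longleftrightarrow> continuous_on {0..c} \<gamma> \<and> \<gamma> 0 = a \<and> (\<forall>s\<in>{0..c}. \<Phi> (\<gamma> s) = y + s *\<^sub>R e)"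
    for c :: real and \<gamma> :: "real \<Rightarrow> 'a"
  \<comment> \<open>The lengths of lifts that stay in the region \<open>\<delta> \<le> J\<close>.
    They are bounded because such lifts run over a bounded part of the line.\<close>
  define T where "T = {c. c \<ge> 0 \<and> (\<exists>\<gamma>. good c \<gamma> \<and> (\<forall>s\<in>{0..c}. J (\<gamma> s) \<ge> \<delta>))}"
  have T0: "0 \<in> T" unfolding T_def good_def using a by (auto intro!: exI[of _ "\<lambda>_. a"])
  have "bounded (\<Phi> ` closure ?L)"
    using bdd cont(1) by (intro compact_imp_bounded compact_continuous_image) (auto intro: continuous_on_subset)
  then obtain B where B: "\<And>x. x \<in> closure ?L \<Longrightarrow> norm (\<Phi> x) \<le> B" unfolding bounded_iff by blast
  have "bdd_above T"
  proof (rule bdd_aboveI)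
    fix c assume "c \<in> T"
    then obtain \<gamma> where c: "c \<ge> 0" "good c \<gamma>" unfolding T_def by blast
    then have \<gamma>: "\<Phi> (\<gamma> c) = y + c *\<^sub>R e" unfolding good_def by simp
    then have "\<gamma> c \<in> ?L" by blast
    then have "\<gamma> c \<in> closure ?L" by (rule subsetD[OF closure_subset])
    from B[OF this] have "norm (y + c *\<^sub>R e) \<le> B" unfolding \<gamma> .
    moreover have "norm (c *\<^sub>R e) \<le> norm (y + c *\<^sub>R e) + norm y"
      using norm_triangle_ineq4[of "y + c *\<^sub>R e" y] by simp
    ultimately show "c \<le> B + norm y" using c(1) e by simp
  qed
  have "\<exists>c\<in>T. Sup T - r/2 < c"
    using r(1) T0 by (intro less_cSupD) auto
  then obtain c where c: "c \<in> T" "Sup T - r/2 < c" by blast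
  then obtain \<gamma> where c0: "c \<ge> 0" and \<gamma>: "good c \<gamma>" "\<And>s. s\<in>{0..c} \<Longrightarrow> J (\<gamma> s) \<ge> \<delta>" unfolding T_def by blast
  have \<gamma>c: "\<Phi> (\<gamma> c) = y + c *\<^sub>R e" using \<gamma>(1) c0 unfolding good_def by simp
  then have "\<gamma> c \<in> ?L" by blast
  then have "\<gamma> c \<in> ?K" using \<gamma>(2)[of c] c0 by (simp add: subsetD[OF closure_subset])
  then obtain g where g: "continuous_on (ball (y + c *\<^sub>R e) r) g"
     "\<And>z. z\<in>ball (y + c *\<^sub>R e) r \<Longrightarrow> \<Phi> (g z) = z" "g (y + c *\<^sub>R e) = \<gamma> c"
    using r(2)[of "\<gamma> c"] \<gamma>c by auto
  \<comment> \<open>As \<open>c\<close> is within \<open>r/2\<close> of \<open>Sup T\<close>, the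
    length \<open>d\<close> exceeds \<open>Sup T\<close>. The prolonged lift exists all the same, so
    it must enter \<open>J < \<delta>\<close>.\<close>
  define d where "d = c + r/2"
  define \<gamma>' where "\<gamma>' s = (if s \<le> c then \<gamma> s else g (y + s *\<^sub>R e))" for s
  have inball: "y + s *\<^sub>R e \<in> ball (y + c *\<^sub>R e) r" if "s \<in> {c..d}" for s
  proof -
    have "norm ((c - s) *\<^sub>R e) = \<bar>c - s\<bar>" using e by simp
    then have "dist (y + c *\<^sub>R e) (y + s *\<^sub>R e) = \<bar>c - s\<bar>"
      by (simp add: dist_norm scaleR_diff_left)
    then show ?thesis using that r(1) unfolding d_def by auto
  qed
  have "continuous_on ({0..c} \<union> {c..d}) \<gamma>'"
    unfolding \<gamma>'_def
  proof (rule continuous_on_cases)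
    show "continuous_on {0..c} \<gamma>" using \<gamma>(1) good_def by blast
    show "continuous_on {c..d} (\<lambda>s. g (y + s *\<^sub>R e))"
      using inball by (intro continuous_on_compose2[OF g(1)] continuous_intros) auto
    show "\<forall>x. x \<in> {0..c} \<and> \<not> x \<le> c \<or> x \<in> {c..d} \<and> x \<le> c \<longrightarrow> \<gamma> x = g (y + x *\<^sub>R e)"
      using g(3) by auto
  qed auto
  moreover have "{0..c} \<union> {c..d} = {0..d}" using c0 r(1) d_def by auto
  ultimately have cont': "continuous_on {0..d} \<gamma>'" by simp
  have \<gamma>'1: "\<Phi> (\<gamma>' s) = y + s *\<^sub>R e" if "s \<in> {0..d}" for s
    using that inball g(2) \<gamma>(1) unfolding \<gamma>'_def good_def by auto
  have \<gamma>'0: "\<gamma>' 0 = a" using \<gamma>(1) c0 unfolding \<gamma>'_def good_def by auto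
  have "d \<notin> T"
    using cSup_upper[OF _ \<open>bdd_above T\<close>, of d] c(2) d_def by auto
  moreover have "good d \<gamma>'" unfolding good_def using cont' \<gamma>'1 \<gamma>'0 by blast
  moreover have "d \<ge> 0" using c0 r(1) d_def by simp
  ultimately have "\<not> (\<forall>s\<in>{0..d}. J (\<gamma>' s) \<ge> \<delta>)" unfolding T_def by blast
  then obtain t where t: "t \<in> {0..d}" "J (\<gamma>' t) < \<delta>" by (auto simp: not_le)
  define f where "f s = J (\<gamma>' s)" for s
  have f: "continuous_on {0..d} f"
    unfolding f_def by (rule continuous_on_compose2[OF cont(2) cont']) auto
  \<comment> \<open>The least element of this compact set is the first parameter at which
    \<open>J\<close> has come down to \<open>\<delta>\<close>; the lift is cut there.\<close>
  let ?Z = "{0..d} \<inter> f -` {..\<delta>}"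
  have "closed ?Z" using f by (rule continuous_closed_preimage) simp_all
  then have Z: "compact ?Z"
    using bounded_subset[OF bounded_closed_interval, of ?Z 0 d]
    by (simp add: compact_eq_bounded_closed)
  have "t \<in> ?Z" using t f_def by simp
  then have "?Z \<noteq> {}" by fast
  from compact_attains_inf[OF Z this]
  obtain u where u: "u \<in> ?Z" "\<And>s. s \<in> ?Z \<Longrightarrow> u \<le> s" by (elim bexE) simp
  have pre: "f s > \<delta>" if "s \<in> {0..<u}" for s
    using u(2)[of s] u(1) that by (force simp: not_le)
  have "f u = \<delta>"
  proof (rule ccontr)
    assume "f u \<noteq> \<delta>"
    then have "f u \<le> \<delta>" "f 0 \<ge> \<delta>" "f u \<noteq> \<delta>" using u(1) a \<gamma>'0 f_def by auto
    moreover have "continuous_on {0..u} f" using f u(1) by (auto intro: continuous_on_subset)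
    ultimately obtain s where "0 \<le> s" "s \<le> u" "f s = \<delta>"
      using IVT2'[of f u \<delta> 0] u(1) by auto
    with pre[of s] \<open>f u \<noteq> \<delta>\<close> show False by (cases "s = u") auto
  qed
  show thesis
  proof (rule that[of u \<gamma>'])
    show "0 \<le> u" "\<gamma>' 0 = a" using u(1) \<gamma>'0 by auto
    show "continuous_on {0..u} \<gamma>'" using cont' u(1) by (auto intro: continuous_on_subset)
    show "J (\<gamma>' u) = \<delta>" using \<open>f u = \<delta>\<close> f_def by simp
    fix s assume "s \<in> {0..u}"
    then show "\<Phi> (\<gamma>' s) = y + s *\<^sub>R e \<and> J (\<gamma>' s) \<ge> \<delta>"
      using \<gamma>'1[of s] pre[of s] \<open>f u = \<delta>\<close> u(1) unfolding f_def by (cases "s = u") auto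
  qed
qed

text \<open>The Khovanskii--Rolle inequality: the end points of the lifts are distinct because lifts
  are unique, and the parameter of a lift is read off its end point.\<close>

lemma injection_into_level_points:
  fixes \<Phi> :: "'a::euclidean_space \<Rightarrow> 'a" and J :: "'a \<Rightarrow> real"
  assumes cont: "continuous_on UNIV \<Phi>" "continuous_on UNIV J"
    and loc: "\<And>x. J x \<ge> \<delta> \<Longrightarrow> \<exists>U V g. open U \<and> x \<in> U \<and> open V \<and> \<Phi> x \<in> V \<and> homeomorphism U V \<Phi> g"
    and bdd: "bounded {x. \<exists>s. \<Phi> x = y + s *\<^sub>R e}" and e: "norm e = 1"
    and A: "\<And>a. a \<in> A \<Longrightarrow> \<Phi> a = y \<and> J a > \<delta>"
  shows "\<exists>b. inj_on b A \<and> (\<forall>a\<in>A. J (b a) = \<delta> \<and> (\<exists>s. \<Phi> (b a) = y + s *\<^sub>R e))"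
proof -
  have "\<exists>c \<gamma>. 0 \<le> c \<and> continuous_on {0..c} \<gamma> \<and> \<gamma> 0 = a \<and>
     (\<forall>s\<in>{0..c}. \<Phi> (\<gamma> s) = y + s *\<^sub>R e \<and> J (\<gamma> s) \<ge> \<delta>) \<and> J (\<gamma> c) = \<delta>" if "a \<in> A" for a
    using lift_until_level[OF cont loc bdd e] A[OF that] by metis
  then obtain c \<gamma> where c: "\<And>a. a \<in> A \<Longrightarrow> 0 \<le> c a \<and> continuous_on {0..c a} (\<gamma> a) \<and> \<gamma> a 0 = a \<and>
     (\<forall>s\<in>{0..c a}. \<Phi> (\<gamma> a s) = y + s *\<^sub>R e \<and> J (\<gamma> a s) \<ge> \<delta>) \<and> J (\<gamma> a (c a)) = \<delta>"
    by metis
  define b where "b a = \<gamma> a (c a)" for a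
  have b: "\<Phi> (b a) = y + c a *\<^sub>R e" if "a \<in> A" for a using c[OF that] unfolding b_def by auto
  have "inj_on b A"
  proof (rule inj_onI)
    fix p q assume pq: "p \<in> A" "q \<in> A" "b p = b q"
    then have "c p *\<^sub>R e = c q *\<^sub>R e" using b by (metis add_left_cancel)
    moreover have "e \<noteq> 0" using e by auto
    ultimately have cc: "c p = c q" by simp
    have "\<gamma> p 0 = \<gamma> q 0"
    \<comment> \<open>Uniqueness is anchored at the common end point and traced back to the
      start.\<close>
    proof (rule lift_unique[of "{0..c p}" _ _ \<Phi> "c p"])
      fix s assume s: "s \<in> {0..c p}"
      show "\<Phi> (\<gamma> p s) = \<Phi> (\<gamma> q s)" using c[OF pq(1)] c[OF pq(2)] s cc by auto
      have "J (\<gamma> p s) \<ge> \<delta>" using c[OF pq(1)] s by auto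
      from loc[OF this] show "\<exists>U. open U \<and> \<gamma> p s \<in> U \<and> inj_on \<Phi> U"
        by (metis homeomorphism_apply1 inj_on_inverseI)
    qed (use c[OF pq(1)] c[OF pq(2)] pq(3) cc in \<open>auto simp: b_def\<close>)
    then show "p = q" using c pq by metis
  qed
  moreover have "J (b a) = \<delta> \<and> (\<exists>s. \<Phi> (b a) = y + s *\<^sub>R e)" if "a \<in> A" for a
    using c[OF that] b[OF that] unfolding b_def by auto
  ultimately show ?thesis by blast
qed

section \<open>Polynomial systems\<close>

text \<open>The inverse function theorem at each point of \<open>A\<close>, within pairwise disjoint
  balls: a nearby right-hand side has at least as many solutions. The neighbourhoods
  \<open>N a\<close> let an open condition on the old solutions pass to the new ones.\<close>

lemma nearby_solutions:
  fixes F :: "'a::euclidean_space \<Rightarrow> 'a"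
  assumes der: "\<And>x. (F has_derivative F' x) (at x)"
    and cont: "\<And>h. continuous_on UNIV (\<lambda>x. F' x h)"
    and A: "finite A" "\<And>a. a \<in> A \<Longrightarrow> inj (F' a) \<and> F a = y \<and> open (N a) \<and> a \<in> N a"
  shows "\<exists>\<epsilon>>0. \<forall>y'\<in>ball y \<epsilon>. \<exists>b. inj_on b A \<and> (\<forall>a\<in>A. F (b a) = y' \<and> b a \<in> N a)"
proof -
  have "\<exists>r>0. \<forall>b\<in>A. b \<noteq> a \<longrightarrow> r \<le> dist a b" for a
    using finite_set_avoid[OF A(1), of a] by (auto simp: dist_commute)
  then obtain r where r: "\<And>a. r a > 0" "\<And>a b. b \<in> A \<Longrightarrow> b \<noteq> a \<Longrightarrow> r a \<le> dist a b" by metis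
  \<comment> \<open>The 1 keeps \<open>Min\<close> defined for empty \<open>A\<close>; the half
    makes the balls of radius \<open>\<rho>\<close> around the points of \<open>A\<close>
    disjoint.\<close>
  define \<rho> where "\<rho> = Min (insert 1 (r ` A)) / 2"
  have "\<rho> > 0" unfolding \<rho>_def using r(1) A(1) by (auto intro!: divide_pos_pos simp: Min_gr_iff)
  have sep: "2 * \<rho> \<le> dist a b" if "a \<in> A" "b \<in> A" "a \<noteq> b" for a b
  proof -
    have "2 * \<rho> \<le> r a" unfolding \<rho>_def using that A(1) by simp
    also have "\<dots> \<le> dist a b" using r(2) that by auto
    finally show ?thesis .
  qed
  have "\<exists>\<epsilon>>0. \<forall>y'\<in>ball y \<epsilon>. \<exists>x. F x = y' \<and> x \<in> N a \<inter> ball a \<rho>" if a: "a \<in> A" for a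
  proof -
    have "inj (F' a)" using A(2)[OF a] by simp
    from local_inverse[of F F', OF der cont this]
    obtain U V g where *: "open U" "a \<in> U" "open V" "F a \<in> V" "homeomorphism U V F g" .
    let ?W = "U \<inter> (N a \<inter> ball a \<rho>)"
    have W: "open ?W" "a \<in> ?W" using * A(2)[OF a] \<open>\<rho> > 0\<close> by auto
    then have "openin (top_of_set U) ?W" using * by (simp add: openin_open_eq)
    with *(5) have "openin (top_of_set V) (F ` ?W)" by (rule homeomorphism_imp_open_map)
    then have "open (F ` ?W)" using *(3) by (simp add: openin_open_eq)
    moreover have "y \<in> F ` ?W" using W(2) A(2)[OF a] by (metis imageI)
    ultimately obtain \<epsilon> where "\<epsilon> > 0" "ball y \<epsilon> \<subseteq> F ` ?W" using open_contains_ball by blast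
    then show ?thesis by (intro exI[of _ \<epsilon>]) blast
  qed
  then obtain \<epsilon> where \<epsilon>: "\<And>a. a \<in> A \<Longrightarrow> \<epsilon> a > 0"
      "\<And>a y'. a \<in> A \<Longrightarrow> y' \<in> ball y (\<epsilon> a) \<Longrightarrow> \<exists>x. F x = y' \<and> x \<in> N a \<inter> ball a \<rho>"
    by metis
  define \<eta> where "\<eta> = Min (insert 1 (\<epsilon> ` A))"
  have "\<eta> > 0" unfolding \<eta>_def using \<epsilon>(1) A(1) by (auto simp: Min_gr_iff)
  moreover have "\<exists>b. inj_on b A \<and> (\<forall>a\<in>A. F (b a) = y' \<and> b a \<in> N a)" if y': "y' \<in> ball y \<eta>" for y'
  proof -
    have "\<exists>x. F x = y' \<and> x \<in> N a \<inter> ball a \<rho>" if "a \<in> A" for a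
    proof (rule \<epsilon>(2)[OF that])
      have "\<eta> \<le> \<epsilon> a" unfolding \<eta>_def using that A(1) by simp
      then show "y' \<in> ball y (\<epsilon> a)" using y' by auto
    qed
    then obtain b where b: "\<And>a. a \<in> A \<Longrightarrow> F (b a) = y' \<and> b a \<in> N a \<inter> ball a \<rho>" by metis
    have "inj_on b A"
    proof (rule inj_onI, rule ccontr)
      fix p q assume pq: "p \<in> A" "q \<in> A" "b p = b q" "p \<noteq> q"
      have "dist p q \<le> dist p (b p) + dist q (b p)" by (rule dist_triangle2)
      also have "\<dots> < 2 * \<rho>" using b[OF pq(1)] b[OF pq(2)] pq(3) by auto
      finally show False using sep pq by fastforce
    qed
    with b show ?thesis by blast
  qed
  ultimately show ?thesis by blast
qed

text \<open>Polynomial functions of total degree at most \<open>d\<close>, generated by the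
  operations used below, so that a degree bound is obtained by applying introduction rules.\<close>

inductive polyd :: "nat \<Rightarrow> (real^'v \<Rightarrow> real) \<Rightarrow> bool" where
  polyd_const: "polyd d (\<lambda>x. c)"
| polyd_coord: "1 \<le> d \<Longrightarrow> polyd d (\<lambda>x. x $ i)"
| polyd_add: "polyd d f \<Longrightarrow> polyd d g \<Longrightarrow> polyd d (\<lambda>x. f x + g x)"
| polyd_mult: "polyd a f \<Longrightarrow> polyd b g \<Longrightarrow> a + b \<le> d \<Longrightarrow> polyd d (\<lambda>x. f x * g x)"

lemma polyd_mono: "polyd d f \<Longrightarrow> d \<le> d' \<Longrightarrow> polyd d' f"
proof (induction rule: polyd.induct)
  case (polyd_mult a f b g d)
  then show ?case using polyd.polyd_mult[of a f b g d'] by simp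
qed (auto intro: polyd.intros)

lemma polyd_cmult: "polyd d f \<Longrightarrow> polyd d (\<lambda>x. c * f x)"
  using polyd_mult[OF polyd_const[of 0 c], of d f d] by simp

lemma polyd_minus: "polyd d f \<Longrightarrow> polyd d (\<lambda>x. - f x)"
  using polyd_cmult[of d f "-1"] by simp

lemma polyd_diff: "polyd d f \<Longrightarrow> polyd d g \<Longrightarrow> polyd d (\<lambda>x. f x - g x)"
  using polyd_add[of d f "\<lambda>x. - g x"] by (simp add: polyd_minus)

lemma polyd_sum: "(\<And>i. i \<in> I \<Longrightarrow> polyd d (f i)) \<Longrightarrow> polyd d (\<lambda>x. \<Sum>i\<in>I. f i x)"
  by (induction I rule: infinite_finite_induct) (auto intro: polyd_const polyd_add)

lemma polyd_prod: "(\<And>i. i \<in> I \<Longrightarrow> polyd d (f i)) \<Longrightarrow> polyd (card I * d) (\<lambda>x. \<Prod>i\<in>I. f i x)"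
  by (induction I rule: infinite_finite_induct)
    (auto intro: polyd_const polyd_mult[of d _ "card _ * d"])

lemma polyd_power: "polyd d f \<Longrightarrow> polyd (n * d) (\<lambda>x. f x ^ n)"
  using polyd_prod[of "{..<n}" d "\<lambda>_. f"] by simp

lemma polyd_continuous: "polyd d f \<Longrightarrow> continuous_on S f"
  by (induction rule: polyd.induct) (auto intro!: continuous_intros)

lemma polyd_has_derivative:
  "polyd d f \<Longrightarrow> \<exists>D. (\<forall>j. polyd d (D j)) \<and>
     (\<forall>x. (f has_derivative (\<lambda>h. \<Sum>j\<in>UNIV. D j x * h $ j)) (at x))"
proof (induction rule: polyd.induct)
  case (polyd_const d c)
  show ?case by (rule exI[of _ "\<lambda>j x. 0"]) (auto intro: polyd.polyd_const)
next
  case (polyd_coord d i)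
  have "((\<lambda>x. x $ i) has_derivative (\<lambda>h. \<Sum>j\<in>UNIV. (if j = i then 1 else 0) * h $ j)) (at x)" for x :: "real^'a"
    using bounded_linear_imp_has_derivative[OF bounded_linear_vec_nth]
    by (simp add: if_distrib[of "\<lambda>z. z * _"] cong: if_cong)
  then show ?case
    by (intro exI[of _ "\<lambda>j x. if j = i then 1 else 0"]) (auto intro: polyd.polyd_const)
next
  case (polyd_add d f g)
  then obtain D E where
    D: "\<And>j. polyd d (D j)" "\<And>x. (f has_derivative (\<lambda>h. \<Sum>j\<in>UNIV. D j x * h $ j)) (at x)" and
    E: "\<And>j. polyd d (E j)" "\<And>x. (g has_derivative (\<lambda>h. \<Sum>j\<in>UNIV. E j x * h $ j)) (at x)"
    by blast
  have "((\<lambda>x. f x + g x) has_derivative (\<lambda>h. \<Sum>j\<in>UNIV. (D j x + E j x) * h $ j)) (at x)" for x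
    using has_derivative_add[OF D(2) E(2)] by (simp add: sum.distrib distrib_right)
  then show ?case using D(1) E(1) by (intro exI[of _ "\<lambda>j x. D j x + E j x"]) (auto intro: polyd.polyd_add)
next
  case (polyd_mult a f b g d)
  then obtain D E where
    D: "\<And>j. polyd a (D j)" "\<And>x. (f has_derivative (\<lambda>h. \<Sum>j\<in>UNIV. D j x * h $ j)) (at x)" and
    E: "\<And>j. polyd b (E j)" "\<And>x. (g has_derivative (\<lambda>h. \<Sum>j\<in>UNIV. E j x * h $ j)) (at x)"
    by blast
  have "((\<lambda>x. f x * g x) has_derivative (\<lambda>h. \<Sum>j\<in>UNIV. (f x * E j x + D j x * g x) * h $ j)) (at x)" for x
    by (rule has_derivative_eq_rhs[OF has_derivative_mult[OF D(2) E(2)]])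
       (simp add: fun_eq_iff sum_distrib_left sum_distrib_right sum.distrib distrib_left distrib_right mult_ac)
  moreover have "polyd d (\<lambda>x. f x * E j x + D j x * g x)" for j
    using D(1) E(1) polyd_mult by (intro polyd.polyd_add polyd.polyd_mult) auto
  ultimately show ?case by (intro exI[of _ "\<lambda>j x. f x * E j x + D j x * g x"]) auto
qed

section \<open>Monomials and a Bezout-type count of zeros\<close>

definition monom_fun :: "('v::finite \<Rightarrow> nat) \<Rightarrow> real^'v \<Rightarrow> real" where
  "monom_fun e x = (\<Prod>i\<in>UNIV. x $ i ^ e i)"

lemma monom_fun_add: "monom_fun (\<lambda>i. e i + e' i) x = monom_fun e x * monom_fun e' x"
  by (simp add: monom_fun_def power_add prod.distrib)

lemma monom_fun_single: "monom_fun (\<lambda>j. if j = i then n else 0) x = x $ i ^ n"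
  unfolding monom_fun_def by (simp add: if_distrib cong: if_cong)

text \<open>The expanded form of a polynomial function: a property closed under sums then has to be
  checked only on scalar multiples of monomials.\<close>

inductive monom_sum :: "nat \<Rightarrow> (real^'v \<Rightarrow> real) \<Rightarrow> bool" where
  monom_sum_base: "(\<Sum>i\<in>UNIV. e i) \<le> d \<Longrightarrow> monom_sum d (\<lambda>x. c * monom_fun e x)"
| monom_sum_add: "monom_sum d f \<Longrightarrow> monom_sum d g \<Longrightarrow> monom_sum d (\<lambda>x. f x + g x)"

lemma monom_sum_mult_monom:
  "monom_sum b g \<Longrightarrow> (\<Sum>i\<in>UNIV. e i) + b \<le> d \<Longrightarrow> monom_sum d (\<lambda>x. (c * monom_fun e x) * g x)"
proof (induction rule: monom_sum.induct)
  case (monom_sum_base e' b c')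
  then show ?case
    using monom_sum.monom_sum_base[of "\<lambda>i. e i + e' i" d "c * c'"]
    by (simp add: monom_fun_add sum.distrib mult_ac)
next
  case (monom_sum_add b f g)
  then show ?case using monom_sum.monom_sum_add by (fastforce simp: distrib_left)
qed

lemma monom_sum_mult:
  "monom_sum a f \<Longrightarrow> monom_sum b g \<Longrightarrow> a + b \<le> d \<Longrightarrow> monom_sum d (\<lambda>x. f x * g x)"
proof (induction rule: monom_sum.induct)
  case (monom_sum_base e a c)
  then show ?case by (intro monom_sum_mult_monom) auto
next
  case (monom_sum_add d f h)
  then show ?case using monom_sum.monom_sum_add by (fastforce simp: distrib_right)
qed

lemma polyd_imp_monom_sum: "polyd d f \<Longrightarrow> monom_sum d f"
proof (induction rule: polyd.induct)
  case (polyd_const d c)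
  then show ?case using monom_sum_base[of "\<lambda>_. 0" d c] by (simp add: monom_fun_def)
next
  case (polyd_coord d i)
  then show ?case using monom_sum_base[of "\<lambda>j. if j = i then 1 else 0" d 1]
    by (simp add: monom_fun_single)
qed (auto intro: monom_sum_add monom_sum_mult)

lemma polyd_monom_fun: "polyd (\<Sum>i\<in>UNIV. e i) (monom_fun e)"
proof -
  have "polyd (\<Sum>i\<in>I. e i) (\<lambda>x. \<Prod>i\<in>I. x $ i ^ e i)" for I
  proof (induction I rule: infinite_finite_induct)
    case (insert i I)
    then show ?case
      using polyd_mult[OF polyd_power[OF polyd_coord[of 1 i], of "e i"] insert.IH] by simp
  qed (auto intro: polyd_const)
  from this[of UNIV] show ?thesis by (simp add: monom_fun_def[abs_def])
qed

text \<open>Gaussian elimination: equation \<open>e\<close> is solved for a pivot unknown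
  \<open>p\<close>, which is then substituted into the remaining equations.\<close>

lemma underdetermined_system:
  fixes M :: "'e \<Rightarrow> 'a \<Rightarrow> 'f::field"
  assumes "finite E" "finite A" "card E < card A"
  shows "\<exists>c. (\<exists>a\<in>A. c a \<noteq> 0) \<and> (\<forall>e\<in>E. (\<Sum>a\<in>A. c a * M e a) = 0)"
  using assms
proof (induction E arbitrary: A M rule: finite_induct)
  case empty
  then show ?case by (intro exI[of _ "\<lambda>_. 1"]) (auto simp: card_gt_0_iff)
next
  case (insert e E)
  show ?case
  proof (cases "\<forall>a\<in>A. M e a = 0")
    case True
    then show ?thesis using insert.IH[of A M] insert.prems insert.hyps by auto
  next
    case False
    then obtain p where p: "p \<in> A" "M e p \<noteq> 0" by blast
    let ?A = "A - {p}"
    have "card E < card ?A" using insert.prems insert.hyps p by simp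
    from insert.IH[OF _ this, of "\<lambda>e' a. M e' a - M e' p * M e a / M e p"] insert.prems(1)
    obtain c where c: "\<exists>a\<in>?A. c a \<noteq> 0"
      "\<And>e'. e' \<in> E \<Longrightarrow> (\<Sum>a\<in>?A. c a * (M e' a - M e' p * M e a / M e p)) = 0" by auto
    define c' where "c' = c(p := - (\<Sum>a\<in>?A. c a * M e a) / M e p)"
    have S: "(\<Sum>a\<in>A. c' a * M e' a) = c' p * M e' p + (\<Sum>a\<in>?A. c a * M e' a)" for e'
      using sum.remove[OF insert.prems(1) p(1), of "\<lambda>a. c' a * M e' a"]
      by (simp add: c'_def)
    have c'p: "c' p = - (\<Sum>a\<in>?A. c a * M e a) / M e p" by (simp add: c'_def)
    have "(\<Sum>a\<in>A. c' a * M e a) = 0" using p(2) unfolding S c'p by simp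
    moreover have "(\<Sum>a\<in>A. c' a * M e' a) = 0" if "e' \<in> E" for e'
      using c(2)[OF that] unfolding S c'p
      by (simp add: right_diff_distrib sum_subtractf sum_distrib_left sum_distrib_right
          sum_divide_distrib algebra_simps)
    moreover have "\<exists>a\<in>A. c' a \<noteq> 0" using c(1) unfolding c'_def by auto
    ultimately show ?thesis by blast
  qed
qed

lemma finite_exponents: "finite {e :: 'v::finite \<Rightarrow> nat. \<forall>i. e i < D}"
  by (rule finite_subset[OF _ finite_PiE[of UNIV "\<lambda>_. {..<D}"]]) auto

text \<open>On the zero set of \<open>P i + t * (x $ i) ^ Suc d\<close>, all of degree at most \<open>Suc d\<close>, powers above \<open>d\<close>
  can be rewritten away; so there are at most \<open>Suc d ^ CARD('v)\<close> linearly independent polynomial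
  functions on it.\<close>

lemma card_zeros_monic_system:
  fixes P :: "'v::finite \<Rightarrow> real^'v \<Rightarrow> real"
  assumes P: "\<And>i. polyd d (P i)" and t: "t \<noteq> 0"
    and A: "finite A" "\<And>x i. x \<in> A \<Longrightarrow> P i x + t * x $ i ^ Suc d = 0"
  shows "card A \<le> card {e :: 'v \<Rightarrow> nat. \<forall>i. e i < Suc d}"
proof -
  let ?E = "{e :: 'v \<Rightarrow> nat. \<forall>i. e i < Suc d}"
  \<comment> \<open>\<open>R f\<close>: on \<open>A\<close>, the function \<open>f\<close> is a
    combination of the monomials with all exponents at most \<open>d\<close>.\<close>
  define R where "R f \<longleftrightarrow> (\<exists>c. \<forall>x\<in>A. f x = (\<Sum>e\<in>?E. c e * monom_fun e x))" for f
  have R_add: "R (\<lambda>x. f x + g x)" if "R f" "R g" for f g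
  proof -
    from that obtain c c' where "\<forall>x\<in>A. f x = (\<Sum>e\<in>?E. c e * monom_fun e x)"
      "\<forall>x\<in>A. g x = (\<Sum>e\<in>?E. c' e * monom_fun e x)" unfolding R_def by blast
    then show ?thesis unfolding R_def
      by (intro exI[of _ "\<lambda>e. c e + c' e"]) (simp add: sum.distrib distrib_right)
  qed
  have R_cmult: "R (\<lambda>x. k * f x)" if "R f" for f k
  proof -
    from that obtain c where "\<forall>x\<in>A. f x = (\<Sum>e\<in>?E. c e * monom_fun e x)" unfolding R_def by blast
    then show ?thesis unfolding R_def
      by (intro exI[of _ "\<lambda>e. k * c e"]) (simp add: sum_distrib_left mult.assoc)
  qed
  have R_monom: "R (monom_fun e)" for e
  proof (induction "\<Sum>i\<in>UNIV. e i" arbitrary: e rule: less_induct)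
    case less
    show ?case
    proof (cases "e \<in> ?E")
      case True
      then show ?thesis unfolding R_def
        by (intro exI[of _ "\<lambda>e'. if e' = e then 1 else 0"])
           (simp add: finite_exponents if_distrib[of "\<lambda>z. z * _"] cong: if_cong)
    next
      case False
      \<comment> \<open>Trading the factor \<open>x $ i ^ Suc d\<close> for
        \<open>- P i x / t\<close> lowers the total degree by at least one, so the induction
        hypothesis applies to every monomial of the result.\<close>
      then obtain i where i: "Suc d \<le> e i" by (auto simp: not_less)
      define e' where "e' j = (if j = i then e i - Suc d else e j)" for j
      have e: "e = (\<lambda>j. e' j + (if j = i then Suc d else 0))" using i by (auto simp: e'_def fun_eq_iff)
      have "(\<Sum>j\<in>UNIV. e j) = (\<Sum>j\<in>UNIV. e' j + (if j = i then Suc d else 0))"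
        by (rule sum.cong[OF refl]) (simp only: e[THEN fun_cong, symmetric])
      then have deg: "(\<Sum>j\<in>UNIV. e j) = (\<Sum>j\<in>UNIV. e' j) + Suc d" by (simp add: sum.distrib)
      let ?q = "\<lambda>x. monom_fun e' x * P i x"
      have "polyd ((\<Sum>j\<in>UNIV. e' j) + d) ?q" by (intro polyd_mult[OF polyd_monom_fun P]) simp
      then have "monom_sum ((\<Sum>j\<in>UNIV. e' j) + d) ?q" by (rule polyd_imp_monom_sum)
      moreover have "R f" if "monom_sum D f" "D < (\<Sum>j\<in>UNIV. e j)" for f D
        using that by (induction rule: monom_sum.induct) (auto intro: R_add R_cmult less le_less_trans)
      ultimately have "R ?q" using deg by simp
      then have "R (\<lambda>x. - (1 / t) * ?q x)" by (rule R_cmult)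
      moreover have "monom_fun e x = - (1 / t) * ?q x" if "x \<in> A" for x
      proof -
        have "monom_fun e x = monom_fun e' x * x $ i ^ Suc d"
          by (subst e) (simp only: monom_fun_add monom_fun_single)
        also have "x $ i ^ Suc d = - (1 / t) * P i x"
          using A(2)[OF that, of i] t by (simp add: field_simps)
        finally show ?thesis by simp
      qed
      ultimately show ?thesis unfolding R_def by simp
    qed
  qed
  have R_poly: "R f" if "polyd D f" for f D
    using polyd_imp_monom_sum[OF that]
    by (induction rule: monom_sum.induct) (auto intro: R_add R_cmult R_monom)
  show ?thesis
  proof (rule ccontr)
    assume "\<not> ?thesis"
    then have "card ?E < card A" by simp
    \<comment> \<open>With more points than reduced monomials, some nontrivial combination of point
      evaluations kills all reduced monomials, hence by \<open>R_poly\<close> every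
      polynomial.\<close>
    from underdetermined_system[OF finite_exponents A(1) this, of monom_fun]
    obtain c a where c: "a \<in> A" "c a \<noteq> 0" "\<And>e. e \<in> ?E \<Longrightarrow> (\<Sum>a\<in>A. c a * monom_fun e a) = 0"
      by blast
    \<comment> \<open>A polynomial that vanishes on \<open>A\<close> except at \<open>a\<close>
      refutes such a combination: only the term \<open>c a * f a\<close> survives.\<close>
    define f where "f x = (\<Prod>b\<in>A - {a}. \<Sum>i\<in>UNIV. (x $ i - b $ i)\<^sup>2)" for x :: "real^'v"
    have "polyd (card (A - {a}) * (2 * 1)) f"
      unfolding f_def by (intro polyd_prod polyd_sum polyd_power polyd_diff polyd_coord polyd_const) simp
    from R_poly[OF this] obtain k where k: "\<And>x. x \<in> A \<Longrightarrow> f x = (\<Sum>e\<in>?E. k e * monom_fun e x)"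
      unfolding R_def by blast
    have "(\<Sum>b\<in>A. c b * f b) = (\<Sum>b\<in>A. \<Sum>e\<in>?E. k e * (c b * monom_fun e b))"
      by (intro sum.cong refl) (simp add: k sum_distrib_left mult_ac)
    also have "\<dots> = (\<Sum>e\<in>?E. k e * (\<Sum>b\<in>A. c b * monom_fun e b))"
      by (subst sum.swap) (simp add: sum_distrib_left)
    also have "\<dots> = 0" using c(3) by simp
    finally have "(\<Sum>b\<in>A. c b * f b) = 0" .
    moreover have "f b = 0" if "b \<in> A" "b \<noteq> a" for b
      unfolding f_def using that A(1) by (intro prod_zero) (auto intro!: bexI[of _ b])
    ultimately have "c a * f a = 0"
      using sum.remove[OF A(1) c(1), of "\<lambda>b. c b * f b"] by simp
    then have "f a = 0" using c(2) by simp
    then obtain b where "b \<in> A" "b \<noteq> a" "(\<Sum>i\<in>UNIV. (a $ i - b $ i)\<^sup>2) = 0"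
      unfolding f_def using A(1) by (auto simp: prod_zero_iff)
    then show False by (auto simp: sum_nonneg_eq_0_iff vec_eq_iff)
  qed
qed

section \<open>The Khovanskii--Rolle step\<close>

definition nondeg :: "('a::real_normed_vector \<Rightarrow> 'a) \<Rightarrow> 'a \<Rightarrow> bool" where
  "nondeg F a \<longleftrightarrow> (\<exists>D. (F has_derivative D) (at a) \<and> inj D)"

lemma nondeg_iff: "(F has_derivative D) (at a) \<Longrightarrow> nondeg F a \<longleftrightarrow> inj D"
  unfolding nondeg_def using has_derivative_unique by blast

lemma has_derivative_vec_lambda:
  fixes f :: "'n::finite \<Rightarrow> 'a::real_normed_vector \<Rightarrow> 'b::euclidean_space"
  assumes "\<And>i. (f i has_derivative f' i) (at x within S)"
  shows "((\<lambda>x. \<chi> i. f i x) has_derivative (\<lambda>h. \<chi> i. f' i h)) (at x within S)"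
  using assms
  by (subst has_derivative_componentwise_within)
     (auto simp: Basis_vec_def inner_axis intro: has_derivative_inner_left)

text \<open>The pencil \<open>P i + t * (x $ i) ^ Suc d\<close> is treated as a single map on pairs \<open>(x, t)\<close>, so that
  the nondegenerate zeros survive for small \<open>t\<close> by the inverse function theorem.\<close>

lemma card_nondeg_zeros_poly:
  fixes P :: "'v::finite \<Rightarrow> real^'v \<Rightarrow> real"
  assumes P: "\<And>i. polyd d (P i)"
    and A: "finite A" "\<And>a. a \<in> A \<Longrightarrow> (\<forall>i. P i a = 0) \<and> nondeg (\<lambda>x. \<chi> i. P i x) a"
  shows "card A \<le> card {e :: 'v \<Rightarrow> nat. \<forall>i. e i < Suc d}"
proof -
  define Q :: "'v \<Rightarrow> real^'v \<Rightarrow> real" where "Q i x = x $ i ^ Suc d" for i x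
  have Q: "polyd (Suc d * 1) (Q i)" for i
    unfolding Q_def by (intro polyd_power polyd_coord) simp
  obtain D where D: "\<And>i j. polyd d (D i j)"
    "\<And>i x. (P i has_derivative (\<lambda>h. \<Sum>j\<in>UNIV. D i j x * h $ j)) (at x)"
    using polyd_has_derivative[OF P] by metis
  obtain E where E: "\<And>i j. polyd (Suc d * 1) (E i j)"
    "\<And>i x. (Q i has_derivative (\<lambda>h. \<Sum>j\<in>UNIV. E i j x * h $ j)) (at x)"
    using polyd_has_derivative[OF Q] by metis
  \<comment> \<open>Keeping \<open>t\<close> as an output makes the derivative at
    \<open>(a, 0)\<close> block triangular with 1 in the \<open>t\<close> block, so it is injective
    together with the derivative of \<open>P\<close> at \<open>a\<close>.\<close>
  define F where "F z = (\<chi> i. P i (fst z) + snd z * Q i (fst z), snd z)" for z :: "(real^'v) \<times> real"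
  define F' where "F' z w = (\<chi> i. (\<Sum>j\<in>UNIV. D i j (fst z) * fst w $ j) +
      (snd z * (\<Sum>j\<in>UNIV. E i j (fst z) * fst w $ j) + snd w * Q i (fst z)), snd w)"
    for z w :: "(real^'v) \<times> real"
  have cmp: "((\<lambda>z. f (fst z)) has_derivative (\<lambda>w. f' (fst w))) (at z)"
    if "(f has_derivative f') (at (fst z))" for f :: "real^'v \<Rightarrow> real" and f' and z :: "(real^'v) \<times> real"
    using has_derivative_compose[OF has_derivative_fst[OF has_derivative_ident] that] by simp
  have der: "(F has_derivative F' z) (at z)" for z
    unfolding F_def F'_def
    by (intro has_derivative_Pair has_derivative_vec_lambda has_derivative_add has_derivative_mult
        has_derivative_snd has_derivative_ident cmp[OF D(2)] cmp[OF E(2)])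
  have pc: "continuous_on UNIV (\<lambda>z. f (fst z))" if "polyd n f" for n f
    by (rule continuous_on_compose2[OF polyd_continuous[OF that, of UNIV]]) (auto intro: continuous_intros)
  have cont: "continuous_on UNIV (\<lambda>z. F' z w)" for w
    unfolding F'_def
    by (intro continuous_intros continuous_on_vec_lambda pc[OF D(1)] pc[OF E(1)] pc[OF Q])
  have inj: "inj (F' (a, 0))" if "a \<in> A" for a
  proof -
    have "((\<lambda>x. \<chi> i. P i x) has_derivative (\<lambda>h. \<chi> i. \<Sum>j\<in>UNIV. D i j a * h $ j)) (at a)"
      by (intro has_derivative_vec_lambda D(2))
    with A(2)[OF that] have *: "inj (\<lambda>h. \<chi> i. \<Sum>j\<in>UNIV. D i j a * h $ j)" by (simp add: nondeg_iff)
    show ?thesis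
    proof (rule injI)
      fix w w' assume eq: "F' (a, 0) w = F' (a, 0) w'"
      then have "snd w = snd w'" by (simp add: F'_def)
      with eq have "(\<chi> i. \<Sum>j\<in>UNIV. D i j a * fst w $ j) = (\<chi> i. \<Sum>j\<in>UNIV. D i j a * fst w' $ j)"
        by (simp add: F'_def vec_eq_iff)
      then have "fst w = fst w'" using * by (rule injD[rotated])
      with \<open>snd w = snd w'\<close> show "w = w'" by (simp add: prod_eq_iff)
    qed
  qed
  have zero: "F (a, 0) = 0" if "a \<in> A" for a
    using A(2)[OF that] by (simp add: F_def zero_prod_def vec_eq_iff)
  have "\<exists>\<epsilon>>0. \<forall>y'\<in>ball 0 \<epsilon>. \<exists>b. inj_on b (A \<times> {0::real}) \<and> (\<forall>a\<in>A \<times> {0}. F (b a) = y' \<and> b a \<in> UNIV)"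
    using A(1) inj zero by (intro nearby_solutions[where N = "\<lambda>_. UNIV", OF der cont]) auto
  then obtain \<epsilon> where \<epsilon>: "\<epsilon> > 0" "\<And>y'. y' \<in> ball 0 \<epsilon> \<Longrightarrow> \<exists>b. inj_on b (A \<times> {0::real}) \<and> (\<forall>a\<in>A \<times> {0}. F (b a) = y')"
    by auto
  \<comment> \<open>Any nonzero \<open>t\<close> below \<open>\<epsilon>\<close> would do: the
    solutions over \<open>(0, t)\<close> are zeros of the system with leading terms
    \<open>t * x $ i ^ Suc d\<close>.\<close>
  define t where "t = \<epsilon> / 2"
  have t: "t \<noteq> 0" using \<epsilon>(1) by (simp add: t_def)
  have "(0, t) \<in> ball (0 :: (real^'v) \<times> real) \<epsilon>" using \<epsilon>(1) by (simp add: t_def norm_Pair)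
  from \<epsilon>(2)[OF this] obtain b where b: "inj_on b (A \<times> {0::real})"
    "\<And>a. a \<in> A \<times> {0} \<Longrightarrow> F (b a) = (0, t)" by blast
  let ?B = "fst ` b ` (A \<times> {0::real})"
  have snd: "snd (b a) = t" if "a \<in> A \<times> {0}" for a using b(2)[OF that] by (simp add: F_def)
  have "inj_on fst (b ` (A \<times> {0}))" using snd by (auto intro!: inj_onI simp: prod_eq_iff)
  then have "card ?B = card A" using b(1) by (simp add: card_image card_cartesian_product)
  moreover have "card ?B \<le> card {e :: 'v \<Rightarrow> nat. \<forall>i. e i < Suc d}"
  proof (rule card_zeros_monic_system[OF P t])
    show "finite ?B" using A(1) by simp
    fix x i assume "x \<in> ?B"
    then obtain a where a: "a \<in> A \<times> {0}" "x = fst (b a)" by blast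
    have "fst (F (b a)) $ i = 0" using b(2)[OF a(1)] by simp
    then show "P i x + t * x $ i ^ Suc d = 0"
      using snd[OF a(1)] unfolding a(2) F_def Q_def by simp
  qed
  ultimately show ?thesis by simp
qed

text \<open>Equation \<open>k\<close> is exchanged for a level of \<open>J\<close>. From each
  solution, the curve on which the other equations hold is followed while equation \<open>k\<close>
  increases, up to the first point where \<open>J\<close> reaches a small positive level. Since
  \<open>\<Phi>\<close> is a local diffeomorphism where \<open>J > 0\<close>, distinct solutions
  yield distinct end points.\<close>

lemma khovanskii_rolle_step:
  fixes \<Phi> :: "real^'v::{finite,wellorder} \<Rightarrow> real^'v::{finite,wellorder}" and J :: "real^'v::{finite,wellorder} \<Rightarrow> real"
  assumes der: "\<And>x. (\<Phi> has_derivative \<Phi>' x) (at x)" "\<And>x. (J has_derivative J' x) (at x)"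
    and cont: "\<And>h. continuous_on UNIV (\<lambda>x. \<Phi>' x h)"
    and i0: "i0 \<noteq> k" "\<And>x. \<Phi> x $ i0 = (norm x)\<^sup>2"
    and inj: "\<And>x. J x > 0 \<Longrightarrow> inj (\<Phi>' x)"
    and A: "finite A" "\<And>a. a \<in> A \<Longrightarrow> \<Phi> a = y \<and> J a > 0"
    and \<Psi>: "\<And>x. \<Psi> x = (\<chi> i. if i = k then J x else \<Phi> x $ i)"
  shows "\<exists>z B. finite B \<and> card B = card A \<and> (\<forall>x\<in>B. \<Psi> x = z \<and> nondeg \<Psi> x)"
proof -
  have c\<Phi>: "continuous_on UNIV \<Phi>" and cJ: "continuous_on UNIV J"
    using der has_derivative_continuous_on[of UNIV] by (metis has_derivative_at_withinI)+
  \<comment> \<open>Half the minimum leaves room: solutions for perturbed right-hand sides still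
    satisfy \<open>J > \<delta>\<close>.\<close>
  define \<delta> where "\<delta> = Min (insert 1 (J ` A)) / 2"
  have min: "Min (insert 1 (J ` A)) > 0" using A by (subst Min_gr_iff) auto
  then have \<delta>: "\<delta> > 0" by (simp add: \<delta>_def)
  have \<delta>A: "\<delta> < J a" if "a \<in> A" for a
  proof -
    have "Min (insert 1 (J ` A)) \<le> J a" using that A(1) by simp
    with min show ?thesis by (simp add: \<delta>_def)
  qed
  have "open (J -` {\<delta><..})" using cJ by (auto intro: open_vimage)
  then have "\<exists>\<epsilon>>0. \<forall>y'\<in>ball y \<epsilon>. \<exists>b. inj_on b A \<and> (\<forall>a\<in>A. \<Phi> (b a) = y' \<and> b a \<in> J -` {\<delta><..})"
    using A inj \<delta>A by (intro nearby_solutions[OF der(1) cont]) auto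
  then obtain \<epsilon> where \<epsilon>: "\<epsilon> > 0"
    "\<And>y'. y' \<in> ball y \<epsilon> \<Longrightarrow> \<exists>b. inj_on b A \<and> (\<forall>a\<in>A. \<Phi> (b a) = y' \<and> b a \<in> J -` {\<delta><..})"
    by blast
  define \<Psi>' where "\<Psi>' x h = (\<chi> i. if i = k then J' x h else \<Phi>' x h $ i)" for x h
  have der\<Psi>: "(\<Psi> has_derivative \<Psi>' x) (at x)" for x
  proof -
    have "((\<lambda>x. \<Phi> x $ i) has_derivative (\<lambda>h. \<Phi>' x h $ i)) (at x)" for i
      using has_derivative_compose[OF der(1) bounded_linear_imp_has_derivative[OF bounded_linear_vec_nth]] .
    then have "((\<lambda>x. if i = k then J x else \<Phi> x $ i) has_derivative (\<lambda>h. if i = k then J' x h else \<Phi>' x h $ i)) (at x)" for i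
      using der(2)[of x] by (cases "i = k") simp_all
    from has_derivative_vec_lambda[OF this] show ?thesis
      unfolding \<Psi>'_def \<Psi>[abs_def] .
  qed
  let ?S = "{x. \<not> inj (\<Psi>' x)}"
  \<comment> \<open>By Sard, the critical values of the new map are negligible; a right-hand side
    \<open>z\<close> off this set makes all end points nondegenerate.\<close>
  have "negligible (\<Psi> ` ?S)"
  proof (rule baby_Sard)
    fix x assume x: "x \<in> ?S"
    show "(\<Psi> has_derivative \<Psi>' x) (at x within ?S)" using der\<Psi> by (rule has_derivative_at_withinI)
    have "linear (\<Psi>' x)" using der\<Psi> has_derivative_linear by blast
    then have "(*v) (matrix (\<Psi>' x)) = \<Psi>' x" by (simp add: fun_eq_iff matrix_works)
    then show "rank (matrix (\<Psi>' x)) < CARD('v)" using x by (simp add: less_rank_noninjective)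
  qed simp
  \<comment> \<open>The vector \<open>z\<close> has two roles: its coordinate \<open>k\<close> is
    the level for \<open>J\<close>, and its other coordinates are the perturbed right-hand sides.
    \<open>r z\<close> is the corresponding right-hand side for \<open>\<Phi>\<close>, from which
    the lifts start.\<close>
  define r where "r z = (\<chi> i. if i = k then y $ k else z $ i)" for z :: "real^'v::{finite,wellorder}"
  have cr: "continuous_on UNIV r"
    unfolding r_def
  proof (rule continuous_on_vec_lambda)
    show "continuous_on UNIV (\<lambda>z. if i = k then y $ k else z $ i)" for i
      by (cases "i = k") (auto intro!: continuous_intros)
  qed
  let ?O = "r -` ball y \<epsilon> \<inter> (\<lambda>z. z $ k) -` {0<..<\<delta>}"
  have "open ?O"
    by (intro open_Int open_vimage cr open_ball open_greaterThanLessThan continuous_intros)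
  moreover have "(\<chi> i. if i = k then \<delta>/2 else y $ i) \<in> ?O"
  proof -
    have "r (\<chi> i. if i = k then \<delta>/2 else y $ i) = y" by (simp add: r_def vec_eq_iff)
    then show ?thesis using \<epsilon>(1) \<delta> by simp
  qed
  ultimately have "\<not> negligible ?O" using open_not_negligible by blast
  then have "\<not> ?O \<subseteq> \<Psi> ` ?S" using \<open>negligible (\<Psi> ` ?S)\<close> negligible_subset by blast
  then obtain z where "z \<in> ?O" "z \<notin> \<Psi> ` ?S" by blast
  then have z: "r z \<in> ball y \<epsilon>" "0 < z $ k" "z $ k < \<delta>" "z \<notin> \<Psi> ` ?S" by simp_all
  from \<epsilon>(2)[OF z(1)] obtain b where b: "inj_on b A" "\<And>a. a \<in> A \<Longrightarrow> \<Phi> (b a) = r z \<and> J (b a) > \<delta>"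
    by auto
  \<comment> \<open>Moving along \<open>axis k 1\<close> leaves component \<open>i0\<close> of the
    value fixed. This component is the squared norm, so all points over the line lie on one
    sphere.\<close>
  have bdd: "bounded {x. \<exists>s. \<Phi> x = r z + s *\<^sub>R axis k 1}"
    unfolding bounded_iff
  proof (intro exI ballI)
    fix x assume "x \<in> {x. \<exists>s. \<Phi> x = r z + s *\<^sub>R axis k 1}"
    then have "\<Phi> x $ i0 = r z $ i0" using i0(1) by (auto simp: axis_def)
    then have "(norm x)\<^sup>2 = z $ i0" using i0 by (simp add: r_def)
    then show "norm x \<le> sqrt (z $ i0)" using real_le_rsqrt by force
  qed
  have loc: "\<exists>U V g. open U \<and> x \<in> U \<and> open V \<and> \<Phi> x \<in> V \<and> homeomorphism U V \<Phi> g" if "z $ k \<le> J x" for x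
  proof -
    have "inj (\<Phi>' x)" using that z(2) by (intro inj) simp
    from local_inverse[of \<Phi> \<Phi>', OF der(1) cont this]
    obtain U V g where "open U" "x \<in> U" "open V" "\<Phi> x \<in> V" "homeomorphism U V \<Phi> g" .
    then show ?thesis by (intro exI conjI)
  qed
  have bA: "\<Phi> c = r z \<and> z $ k < J c" if c: "c \<in> b ` A" for c
  proof -
    from c obtain a where a: "c = b a" "a \<in> A" by (rule imageE)
    show ?thesis using b(2)[OF a(2)] z(3) unfolding a(1) by linarith
  qed
  have "\<exists>b'. inj_on b' (b ` A) \<and> (\<forall>c\<in>b ` A. J (b' c) = z $ k \<and> (\<exists>s. \<Phi> (b' c) = r z + s *\<^sub>R axis k 1))"
    using loc bA by (intro injection_into_level_points c\<Phi> cJ bdd norm_axis_1)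
  then obtain b' where b': "inj_on b' (b ` A)"
    and level: "\<forall>c\<in>b ` A. J (b' c) = z $ k \<and> (\<exists>s. \<Phi> (b' c) = r z + s *\<^sub>R axis k 1)"
    by (elim exE conjE)
  show ?thesis
  proof (intro exI[of _ z] exI[of _ "b' ` b ` A"] conjI ballI)
    show "finite (b' ` b ` A)" using A(1) by simp
    show "card (b' ` b ` A) = card A" using b(1) b' by (simp add: card_image)
    fix x assume "x \<in> b' ` b ` A"
    then obtain c where c: "c \<in> b ` A" "x = b' c" by blast
    have "\<Psi> x = z"
      using bspec[OF level c(1)] unfolding \<Psi> c(2) by (auto simp: vec_eq_iff r_def axis_def)
    moreover from this have "inj (\<Psi>' x)" using z(4) by blast
    ultimately show "\<Psi> x = z" "nondeg \<Psi> x" by (simp_all add: nondeg_iff[OF der\<Psi>])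
  qed
qed

section \<open>Systems with exponential factors\<close>

text \<open>A row with \<open>b i = 0\<close> is polynomial, so the number of nonzero rates measures
  how far the system is from a polynomial one.\<close>

definition exp_system ::
    "('v::finite \<Rightarrow> real^'v \<Rightarrow> real) \<Rightarrow> ('v \<Rightarrow> real) \<Rightarrow> ('v \<Rightarrow> 'v) \<Rightarrow> real^'v \<Rightarrow> real^'v" where
  "exp_system P b v x = (\<chi> i. P i x * exp (- b i * x $ v i))"

lemma polyd_det:
  fixes M :: "'v::finite \<Rightarrow> 'v \<Rightarrow> real^'v \<Rightarrow> real"
  assumes "\<And>i j. polyd d (M i j)"
  shows "polyd (CARD('v) * d) (\<lambda>x. det (\<chi> i j. M i j x))"
  unfolding det_def by (auto intro!: polyd_sum polyd_cmult polyd_prod assms)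

text \<open>The entries \<open>M i j\<close> are those of the Jacobian matrix after the factor \<open>exp (- b i * x $ v i)\<close>
  has been taken out of row \<open>i\<close>.\<close>

lemma exp_system_derivative:
  fixes P :: "'v::finite \<Rightarrow> real^'v \<Rightarrow> real"
  assumes "\<And>i. polyd d (P i)"
  obtains M :: "'v \<Rightarrow> 'v \<Rightarrow> real^'v \<Rightarrow> real" and \<Phi>' where
    "\<forall>i j. polyd d (M i j)" "\<forall>x. (exp_system P b v has_derivative \<Phi>' x) (at x)"
    "\<forall>h. continuous_on UNIV (\<lambda>x. \<Phi>' x h)"
    "\<forall>x. inj (\<Phi>' x) \<longleftrightarrow> det (\<chi> i j. M i j x) \<noteq> 0"
proof -
  obtain D where D: "\<And>i j. polyd d (D i j)"
    "\<And>i x. (P i has_derivative (\<lambda>h. \<Sum>j\<in>UNIV. D i j x * h $ j)) (at x)"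
    using polyd_has_derivative[OF assms] by metis
  define M where "M i j x = D i j x - (if j = v i then b i else 0) * P i x" for i j x
  define c where "c i x = exp (- b i * x $ v i)" for i and x :: "real^'v"
  define N where "N x = (\<chi> i j. c i x * M i j x)" for x :: "real^'v"
  have M: "polyd d (M i j)" for i j
    unfolding M_def by (intro polyd_diff polyd_cmult D(1) assms)
  have c: "(c i has_derivative (\<lambda>h. c i x * (- b i * h $ v i))) (at x)" for i x
    unfolding c_def
    by (rule derivative_eq_intros bounded_linear_imp_has_derivative bounded_linear_vec_nth refl)+ (simp add: mult_ac)
  have cc: "continuous_on S (c i)" for S i
    unfolding c_def by (intro continuous_intros)
  have row: "((\<lambda>x. P i x * c i x) has_derivative (\<lambda>h. (N x *v h) $ i)) (at x)" for i x
  proof (rule has_derivative_eq_rhs[OF has_derivative_mult[OF D(2) c]], rule ext)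
    fix h :: "real^'v"
    have "(\<Sum>j\<in>UNIV. M i j x * h $ j) = (\<Sum>j\<in>UNIV. D i j x * h $ j) - b i * P i x * h $ v i"
      unfolding M_def left_diff_distrib sum_subtractf
      by (simp add: if_distrib[of "\<lambda>z. z * _"] cong: if_cong)
    then show "P i x * (c i x * (- b i * h $ v i)) + (\<Sum>j\<in>UNIV. D i j x * h $ j) * c i x = (N x *v h) $ i"
      by (simp add: N_def matrix_vector_mult_def mult.assoc flip: sum_distrib_left) (simp add: algebra_simps)
  qed
  have "(exp_system P b v has_derivative (\<lambda>h. N x *v h)) (at x)" for x
    using has_derivative_vec_lambda[of "\<lambda>i x. P i x * c i x", OF row]
    unfolding exp_system_def[abs_def] c_def by simp
  moreover have "continuous_on UNIV (\<lambda>x. N x *v h)" for h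
    unfolding N_def matrix_vector_mult_def
    by (simp, intro continuous_intros continuous_on_vec_lambda cc polyd_continuous[OF M])
  moreover have "inj ((*v) (N x)) \<longleftrightarrow> det (\<chi> i j. M i j x) \<noteq> 0" for x
  proof -
    have "N x = (\<chi> i. c i x *s (\<chi> j. M i j x))" by (simp add: N_def vec_eq_iff)
    then have "det (N x) = (\<Prod>i\<in>UNIV. c i x) * det (\<chi> i j. M i j x)" by (simp add: det_rows_mul)
    moreover have "(\<Prod>i\<in>UNIV. c i x) \<noteq> 0" by (simp add: c_def)
    ultimately show ?thesis
      using det_nz_iff_inj[OF matrix_vector_mul_linear, of "N x"] by simp
  qed
  ultimately show thesis using M by (intro that[of M "\<lambda>x. (*v) (N x)"] allI)
qed

text \<open>Induction on the number \<open>K\<close> of genuine exponentials, with the degree left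
  free because the determinant that replaces a row has larger degree. \<open>C\<close> is chosen
  before the polynomials, the rates and the right-hand side, which is the uniformity the theorem
  asks for.\<close>

lemma nondeg_solutions_bound:
  "\<exists>C. \<forall>(P :: 'v::{finite,wellorder} \<Rightarrow> real^'v::{finite,wellorder} \<Rightarrow> real) b v y A.
     (\<forall>i. polyd d (P i)) \<longrightarrow> b i0 = 0 \<longrightarrow> (\<forall>x. P i0 x = (norm x)\<^sup>2) \<longrightarrow> card {i. b i \<noteq> 0} = K \<longrightarrow>
     finite A \<longrightarrow> (\<forall>a\<in>A. exp_system P b v a = y \<and> nondeg (exp_system P b v) a) \<longrightarrow> card A \<le> C"
proof (induction K arbitrary: d)
  case 0
  show ?case
  proof (intro exI[of _ "card {e :: 'v \<Rightarrow> nat. \<forall>i. e i < Suc d}"] allI impI)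
    fix P :: "'v \<Rightarrow> (real, 'v) vec \<Rightarrow> real" and b v y A
    assume P: "\<forall>i. polyd d (P i)" and b: "card {i. b i \<noteq> 0} = 0" and A: "finite A"
      "\<forall>a\<in>A. exp_system P b v a = y \<and> nondeg (exp_system P b v) a"
    show "card A \<le> card {e :: 'v \<Rightarrow> nat. \<forall>i. e i < Suc d}"
    proof (rule card_nondeg_zeros_poly[of d "\<lambda>i x. P i x - y $ i"])
      show "polyd d (\<lambda>x. P i x - y $ i)" for i using P by (intro polyd_diff polyd_const) simp
      fix a assume a: "a \<in> A"
      with A obtain D where D: "(exp_system P b v has_derivative D) (at a)" "inj D"
        unfolding nondeg_def by blast
      have eq: "(\<lambda>x. \<chi> i. P i x - y $ i) = (\<lambda>x. exp_system P b v x - y)"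
        using b by (simp add: exp_system_def fun_eq_iff vec_eq_iff)
      have "nondeg (\<lambda>x. \<chi> i. P i x - y $ i) a"
        unfolding nondeg_def eq using has_derivative_diff[OF D(1) has_derivative_const[of y]] D(2)
        by auto
      moreover have "P i a - y $ i = 0" for i
        using A(2) a b by (auto simp: exp_system_def vec_eq_iff)
      ultimately show "(\<forall>i. P i a - y $ i = 0) \<and> nondeg (\<lambda>x. \<chi> i. P i x - y $ i) a" by simp
    qed (rule A(1))
  qed
next
  case (Suc K)
  let ?d = "max d (CARD('v) * d)"
  from Suc.IH[of ?d] obtain C where C:
    "\<And>(P :: 'v \<Rightarrow> (real, 'v) vec \<Rightarrow> real) b v y A. (\<forall>i. polyd ?d (P i)) \<Longrightarrow> b i0 = 0 \<Longrightarrow>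
       (\<forall>x. P i0 x = (norm x)\<^sup>2) \<Longrightarrow> card {i. b i \<noteq> 0} = K \<Longrightarrow> finite A \<Longrightarrow>
       (\<forall>a\<in>A. exp_system P b v a = y \<and> nondeg (exp_system P b v) a) \<Longrightarrow> card A \<le> C"
    by blast
  show ?case
  proof (intro exI[of _ "2 * C"] allI impI)
    fix P :: "'v \<Rightarrow> (real, 'v) vec \<Rightarrow> real" and b v y A
    assume P: "\<forall>i. polyd d (P i)" and i0: "b i0 = 0" "\<forall>x. P i0 x = (norm x)\<^sup>2"
      and b: "card {i. b i \<noteq> 0} = Suc K" and A: "finite A"
      "\<forall>a\<in>A. exp_system P b v a = y \<and> nondeg (exp_system P b v) a"
    let ?\<Phi> = "exp_system P b v"
    from b obtain k where k: "b k \<noteq> 0" by (metis (mono_tags) Collect_empty_eq card.empty nat.distinct(1))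
    have "\<And>i. polyd d (P i)" using P by simp
    from exp_system_derivative[where P = P and b = b and v = v, OF this]
    obtain M :: "'v \<Rightarrow> 'v \<Rightarrow> (real, 'v) vec \<Rightarrow> real" and \<Phi>' where *: "\<forall>i j. polyd d (M i j)"
      "\<forall>x. (?\<Phi> has_derivative \<Phi>' x) (at x)" "\<forall>h. continuous_on UNIV (\<lambda>x. \<Phi>' x h)"
      "\<forall>x. inj (\<Phi>' x) \<longleftrightarrow> det (\<chi> i j. M i j x) \<noteq> 0" .
    from * have M: "\<And>i j. polyd d (M i j)" and
      \<Phi>': "\<And>x. (?\<Phi> has_derivative \<Phi>' x) (at x)" "\<And>h. continuous_on UNIV (\<lambda>x. \<Phi>' x h)"
      and inj: "\<And>x. inj (\<Phi>' x) \<longleftrightarrow> det (\<chi> i j. M i j x) \<noteq> 0" by simp_all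
    define J where "J x = det (\<chi> i j. M i j x)" for x
    have J: "polyd ?d J"
      unfolding J_def using polyd_mono[OF polyd_det[of d M, OF M]] by simp
    \<comment> \<open>Used for \<open>\<sigma>\<close> equal to 1 and -1. At a nondegenerate
      solution \<open>J\<close> is nonzero, so the two cases cover \<open>A\<close>.\<close>
    have half: "card {a \<in> A. \<sigma> * J a > 0} \<le> C" for \<sigma> :: real
    proof -
      \<comment> \<open>Row \<open>k\<close> loses its exponential and prescribes a level of the
        determinant instead: again an exponential system, with one nonzero rate fewer.\<close>
      let ?J = "\<lambda>x. \<sigma> * J x" and ?P = "P(k := \<lambda>x. \<sigma> * J x)" and ?b = "b(k := 0)"
      have PJ: "polyd ?d ?J" by (rule polyd_cmult[OF J])
      from polyd_has_derivative[OF this] obtain E where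
        "\<forall>x. (?J has_derivative (\<lambda>h. \<Sum>j\<in>UNIV. E j x * h $ j)) (at x)" by (elim exE conjE)
      then have J': "(?J has_derivative (\<lambda>h. \<Sum>j\<in>UNIV. E j x * h $ j)) (at x)" for x by (rule spec)
      have \<Psi>: "exp_system ?P ?b v x = (\<chi> i. if i = k then ?J x else ?\<Phi> x $ i)" for x
        by (simp add: exp_system_def vec_eq_iff)
      have "\<exists>z B. finite B \<and> card B = card {a \<in> A. ?J a > 0} \<and>
        (\<forall>x\<in>B. exp_system ?P ?b v x = z \<and> nondeg (exp_system ?P ?b v) x)"
      proof (rule khovanskii_rolle_step[OF \<Phi>'(1) J' \<Phi>'(2) _ _ _ _ _ \<Psi>])
        show "i0 \<noteq> k" using i0 k by auto
        show "?\<Phi> x $ i0 = (norm x)\<^sup>2" for x using i0 by (simp add: exp_system_def)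
        show "inj (\<Phi>' x)" if "?J x > 0" for x using that inj[of x] by (auto simp: J_def)
      qed (use A in auto)
      then obtain z B where B: "finite B" "card B = card {a \<in> A. ?J a > 0}"
        "\<forall>x\<in>B. exp_system ?P ?b v x = z \<and> nondeg (exp_system ?P ?b v) x" by (elim exE conjE)
      have "card B \<le> C"
      proof (rule C)
        show "\<forall>i. polyd ?d (?P i)" using P PJ polyd_mono[of d _ ?d] by auto
        show "?b i0 = 0" "\<forall>x. ?P i0 x = (norm x)\<^sup>2" using i0 k by auto
        have "{i. ?b i \<noteq> 0} = {i. b i \<noteq> 0} - {k}" by auto
        then show "card {i. ?b i \<noteq> 0} = K" using b k by simp
      qed (rule B)+
      with B(2) show ?thesis by simp
    qed
    have "J a \<noteq> 0" if "a \<in> A" for a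
      using A(2) that inj nondeg_iff[OF \<Phi>'(1)] by (auto simp: J_def)
    then have "A = {a \<in> A. 1 * J a > 0} \<union> {a \<in> A. - 1 * J a > 0}" by (auto simp: neq_iff)
    from arg_cong[OF this, of card]
    have "card A \<le> card {a \<in> A. 1 * J a > 0} + card {a \<in> A. - 1 * J a > 0}"
      using card_Un_le by (rule ord_eq_le_trans)
    with half[of 1] half[of "-1"] show "card A \<le> 2 * C" by linarith
  qed
qed

section \<open>The potential and its derivatives\<close>

text \<open>With this constant the logarithmic and the power potential have the same gradient,
  \<open>- newton_coeff \<alpha>\<close> times \<open>force \<alpha>\<close>; the separate treatment
  of exponent 0 ends here.\<close>

definition newton_coeff :: "real \<Rightarrow> real" where
  "newton_coeff \<alpha> = (if \<alpha> = 0 then 1 else \<alpha>)"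

definition newton_exp :: "real \<Rightarrow> real" where
  "newton_exp \<alpha> = - (\<alpha> + 2) / 2"

definition pair_pot :: "real \<Rightarrow> real^2 \<Rightarrow> real" where
  "pair_pot \<alpha> p = (if \<alpha> = 0 then - ln (p \<bullet> p) / 2 else (p \<bullet> p) powr (- (\<alpha> / 2)))"

definition force :: "real \<Rightarrow> real^2 \<Rightarrow> real^2" where
  "force \<alpha> p = (p \<bullet> p) powr newton_exp \<alpha> *\<^sub>R p"

definition dforce :: "real \<Rightarrow> real^2 \<Rightarrow> real^2 \<Rightarrow> real^2" where
  "dforce \<alpha> p h = (2 * newton_exp \<alpha> * (p \<bullet> p) powr newton_exp \<alpha> / (p \<bullet> p) * (p \<bullet> h)) *\<^sub>R p
     + (p \<bullet> p) powr newton_exp \<alpha> *\<^sub>R h"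

text \<open>The gradient of \<open>cc_fun\<close> with the factor \<open>m i\<close> divided out of
  component \<open>i\<close>. For nonzero masses it has the same zeros, and at a configuration
  without collisions its derivative has the same kernel as the Hessian.\<close>

definition cc_field :: "real \<Rightarrow> ('n::finite \<Rightarrow> real) \<Rightarrow> 'n config \<Rightarrow> 'n config" where
  "cc_field \<alpha> m q = (\<chi> i. q $ i - (\<Sum>j\<in>UNIV. (newton_coeff \<alpha> * m j) *\<^sub>R force \<alpha> (q $ i - q $ j)))"

definition dcc_field :: "real \<Rightarrow> ('n::finite \<Rightarrow> real) \<Rightarrow> 'n config \<Rightarrow> 'n config \<Rightarrow> 'n config" where
  "dcc_field \<alpha> m q h = (\<chi> i. h $ i - (\<Sum>j\<in>UNIV. (newton_coeff \<alpha> * m j) *\<^sub>R dforce \<alpha> (q $ i - q $ j) (h $ i - h $ j)))"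

lemma notin_collision_set:
  "q \<notin> collision_set \<longleftrightarrow> (\<forall>i j. i \<noteq> j \<longrightarrow> q $ i \<noteq> q $ j)"
  unfolding collision_set_def by (auto simp: neq_iff) metis

lemma open_noncollision: "open (- collision_set :: ('n::{finite,linorder}) config set)"
proof -
  have eq: "(collision_set :: 'n config set) = (\<Union>i. \<Union>j\<in>{i<..}. {q. q $ i = q $ j})"
    unfolding collision_set_def by auto
  have "closed (collision_set :: 'n config set)"
    unfolding eq by (intro closed_UN closed_Collect_eq continuous_intros ballI) simp_all
  then show ?thesis by (simp add: open_Compl)
qed

lemma potential_eq: "potential \<alpha> m q = (\<Sum>(i, j)\<in>{(i, j). i < j}. m i * m j * pair_pot \<alpha> (q $ i - q $ j))"
proof -
  have 0: "pair_pot 0 p = - ln (norm p)" for p :: "real^2"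
    by (cases "p = 0") (simp_all add: pair_pot_def norm_eq_sqrt_inner ln_sqrt)
  have "norm p powr \<alpha> = (p \<bullet> p) powr (\<alpha> / 2)" for p :: "real^2"
    by (simp add: norm_eq_sqrt_inner powr_powr powr_half_sqrt[symmetric])
  then have 1: "pair_pot \<alpha> p = 1 / norm p powr \<alpha>" if "\<alpha> \<noteq> 0" for p :: "real^2"
    using that by (simp add: pair_pot_def powr_minus_divide)
  show ?thesis
    by (cases "\<alpha> = 0") (simp_all add: potential_def 0 1 case_prod_unfold sum_negf)
qed

lemma has_derivative_inner_self:
  "((\<lambda>p. p \<bullet> p) has_derivative (\<lambda>h. 2 * (p \<bullet> h))) (at (p::'a::real_inner))"
  by (auto intro!: derivative_eq_intros simp: inner_commute)

lemma has_derivative_pair_pot: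
  assumes "p \<noteq> 0"
  shows "(pair_pot \<alpha> has_derivative (\<lambda>h. - newton_coeff \<alpha> * (force \<alpha> p \<bullet> h))) (at p)"
proof -
  have s: "p \<bullet> p > 0" using assms by simp
  show ?thesis
  proof (cases "\<alpha> = 0")
    case True
    have "((\<lambda>s. - ln s / 2) has_real_derivative - 1 / (2 * (p \<bullet> p))) (at (p \<bullet> p))"
      using s by (auto intro!: derivative_eq_intros)
    from DERIV_compose_FDERIV[OF this has_derivative_inner_self] True s show ?thesis
      by (simp add: pair_pot_def[abs_def] newton_coeff_def force_def newton_exp_def powr_minus_divide
          field_simps)
  next
    case False
    have "((\<lambda>s. s powr (- (\<alpha> / 2))) has_real_derivative - (\<alpha> / 2) * (p \<bullet> p) powr (- (\<alpha> / 2) - 1)) (at (p \<bullet> p))"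
      using s by (rule has_real_derivative_powr)
    moreover have "- (\<alpha> / 2) - 1 = newton_exp \<alpha>" by (simp add: newton_exp_def field_simps)
    ultimately have "((\<lambda>s. s powr (- (\<alpha> / 2))) has_real_derivative - (\<alpha> / 2) * (p \<bullet> p) powr newton_exp \<alpha>) (at (p \<bullet> p))"
      by simp
    from DERIV_compose_FDERIV[OF this has_derivative_inner_self] False show ?thesis
      by (simp add: pair_pot_def[abs_def] newton_coeff_def force_def mult_ac)
  qed
qed

lemma has_derivative_force:
  assumes "p \<noteq> 0"
  shows "(force \<alpha> has_derivative dforce \<alpha> p) (at p)"
proof -
  let ?\<beta> = "newton_exp \<alpha>"
  have s: "p \<bullet> p > 0" using assms by simp
  have "((\<lambda>s. s powr ?\<beta>) has_real_derivative ?\<beta> * (p \<bullet> p) powr (?\<beta> - 1)) (at (p \<bullet> p))"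
    using s by (rule has_real_derivative_powr)
  then have "((\<lambda>s. s powr ?\<beta>) has_real_derivative ?\<beta> * ((p \<bullet> p) powr ?\<beta> / (p \<bullet> p))) (at (p \<bullet> p))"
    using s by (simp add: powr_diff)
  from has_derivative_scaleR[OF DERIV_compose_FDERIV[OF this has_derivative_inner_self] has_derivative_ident]
  show ?thesis
    unfolding force_def[abs_def] by (rule has_derivative_eq_rhs) (simp add: fun_eq_iff dforce_def)
qed

text \<open>These values make the diagonal terms \<open>j = i\<close> vanish, so the sums may run
  over all bodies.\<close>

lemma dforce_zero [simp]: "dforce \<alpha> 0 0 = 0" and force_zero [simp]: "force \<alpha> 0 = 0"
  by (simp_all add: dforce_def force_def)

lemma force_minus: "force \<alpha> (- p) = - force \<alpha> p"
  and dforce_minus: "dforce \<alpha> (- p) (- h) = - dforce \<alpha> p h"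
  by (simp_all add: force_def dforce_def)

lemma has_derivative_vec_nth_diff:
  "((\<lambda>q::('a::real_normed_vector)^'n. q $ i - q $ j) has_derivative (\<lambda>h. h $ i - h $ j)) F"
  by (intro has_derivative_diff bounded_linear_imp_has_derivative bounded_linear_vec_nth)

lemma sum_less_pairs:
  fixes f :: "'n::{finite,linorder} \<Rightarrow> 'n \<Rightarrow> real"
  assumes "\<And>i. f i i = 0"
  shows "(\<Sum>(i, j)\<in>{(i, j). i < j}. f i j + f j i) = (\<Sum>i\<in>UNIV. \<Sum>j\<in>UNIV. f i j)"
proof -
  have "(\<Sum>i\<in>UNIV. \<Sum>j\<in>UNIV. f i j) = (\<Sum>(i, j)\<in>UNIV. f i j)"
    by (simp add: sum.cartesian_product)
  also have "(UNIV :: ('n \<times> 'n) set) = {(i, j). i < j} \<union> ({(i, j). j < i} \<union> {(i, j). i = j})" by auto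
  also have "(\<Sum>(i, j)\<in>\<dots>. f i j) = (\<Sum>(i, j)\<in>{(i, j). i < j}. f i j) +
      ((\<Sum>(i, j)\<in>{(i, j). j < i}. f i j) + (\<Sum>(i, j)\<in>{(i, j). i = j}. f i j))"
    by (subst sum.union_disjoint, simp, simp, force, subst sum.union_disjoint) (auto simp: disjoint_iff)
  also have "(\<Sum>(i, j)\<in>{(i, j). i = j}. f i j) = 0" using assms by (intro sum.neutral) auto
  also have "(\<Sum>(i, j)\<in>{(i, j). j < i}. f i j) = (\<Sum>(i, j)\<in>{(i, j). i < j}. f j i)"
    by (rule sum.reindex_bij_witness[where i = "\<lambda>(i, j). (j, i)" and j = "\<lambda>(i, j). (j, i)"]) auto
  finally show ?thesis by (simp add: sum.distrib case_prod_unfold)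
qed

lemma has_derivative_potential:
  fixes q :: "('n::{finite,linorder}) config"
  assumes q: "q \<notin> collision_set"
  shows "(potential \<alpha> m has_derivative
    (\<lambda>h. \<Sum>i\<in>UNIV. h $ i \<bullet> (m i *\<^sub>R (cc_field \<alpha> m q $ i - q $ i)))) (at q)"
proof -
  let ?\<kappa> = "newton_coeff \<alpha>"
  let ?D = "\<lambda>h. \<Sum>(i, j)\<in>{(i, j). i < j}. m i * m j * (- ?\<kappa> * (force \<alpha> (q $ i - q $ j) \<bullet> (h $ i - h $ j)))"
  have "((\<lambda>q. \<Sum>x\<in>{(i, j). i < j}. m (fst x) * m (snd x) * pair_pot \<alpha> (q $ fst x - q $ snd x)) has_derivative
     (\<lambda>h. \<Sum>x\<in>{(i, j). i < j}. m (fst x) * m (snd x) *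
        (- ?\<kappa> * (force \<alpha> (q $ fst x - q $ snd x) \<bullet> (h $ fst x - h $ snd x))))) (at q)"
  proof (intro has_derivative_sum has_derivative_mult_right)
    fix x :: "'n \<times> 'n" assume "x \<in> {(i, j). i < j}"
    then have "q $ fst x - q $ snd x \<noteq> 0" using q unfolding notin_collision_set by auto
    from has_derivative_compose[OF has_derivative_vec_nth_diff has_derivative_pair_pot[OF this]]
    show "((\<lambda>q. pair_pot \<alpha> (q $ fst x - q $ snd x)) has_derivative
      (\<lambda>h. - ?\<kappa> * (force \<alpha> (q $ fst x - q $ snd x) \<bullet> (h $ fst x - h $ snd x)))) (at q)" .
  qed
  then have "(potential \<alpha> m has_derivative ?D) (at q)"
    unfolding potential_eq[abs_def] by (simp add: case_prod_unfold)
  moreover have "?D h = (\<Sum>i\<in>UNIV. h $ i \<bullet> (m i *\<^sub>R (cc_field \<alpha> m q $ i - q $ i)))" for h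
  proof -
    \<comment> \<open>The factor \<open>h $ i - h $ j\<close> is split between the two bodies; as
      the force is antisymmetric, both halves are values of the same \<open>?f\<close>.\<close>
    let ?f = "\<lambda>i j. - ?\<kappa> * m i * m j * (force \<alpha> (q $ i - q $ j) \<bullet> h $ i)"
    have fm: "force \<alpha> (q $ j - q $ i) = - force \<alpha> (q $ i - q $ j)" for i j
      using force_minus[of \<alpha> "q $ i - q $ j"] by simp
    have "m i * m j * (- ?\<kappa> * (force \<alpha> (q $ i - q $ j) \<bullet> (h $ i - h $ j))) = ?f i j + ?f j i" for i j
      unfolding fm[of j i] by (simp add: inner_diff_right algebra_simps)
    then have "?D h = (\<Sum>(i, j)\<in>{(i, j). i < j}. ?f i j + ?f j i)" by simp
    also have "\<dots> = (\<Sum>i\<in>UNIV. \<Sum>j\<in>UNIV. ?f i j)" by (rule sum_less_pairs) simp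
    also have "\<dots> = (\<Sum>i\<in>UNIV. h $ i \<bullet> (m i *\<^sub>R (cc_field \<alpha> m q $ i - q $ i)))"
      by (intro sum.cong refl)
        (simp add: cc_field_def inner_sum_right sum_distrib_left sum_negf inner_commute mult_ac)
    finally show ?thesis .
  qed
  ultimately show ?thesis by simp
qed

lemma gradient_eqI: "(f has_derivative (\<lambda>h. h \<bullet> D)) (at x) \<Longrightarrow> gradient f x = D"
  unfolding gradient_def gderiv_def
  by (rule the_equality, assumption)
     (metis (no_types, lifting) has_derivative_unique inner_commute vector_eq_rdot)

lemma partial_gradient_potential:
  fixes q :: "('n::{finite,linorder}) config"
  assumes "q \<notin> collision_set"
  shows "partial_gradient i (potential \<alpha> m) q = m i *\<^sub>R (cc_field \<alpha> m q $ i - q $ i)"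
  unfolding partial_gradient_def
proof (rule gradient_eqI)
  have "((\<lambda>x. if j = i then x else q $ j) has_derivative (\<lambda>h. if j = i then h else 0)) (at (q $ i))" for j
    by (cases "j = i") auto
  then have ins: "((\<lambda>x. \<chi> j. if j = i then x else q $ j) has_derivative (\<lambda>h. \<chi> j. if j = i then h else 0)) (at (q $ i))"
    by (rule has_derivative_vec_lambda)
  have "(\<chi> j. if j = i then q $ i else q $ j) = q" by (simp add: vec_eq_iff)
  then have "(potential \<alpha> m has_derivative
    (\<lambda>h. \<Sum>i\<in>UNIV. h $ i \<bullet> (m i *\<^sub>R (cc_field \<alpha> m q $ i - q $ i)))) (at (\<chi> j. if j = i then q $ i else q $ j))"
    using has_derivative_potential[OF assms] by simp
  from has_derivative_compose[OF ins this]
  show "((\<lambda>x. potential \<alpha> m (\<chi> j. if j = i then x else q $ j)) has_derivative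
      (\<lambda>h. h \<bullet> (m i *\<^sub>R (cc_field \<alpha> m q $ i - q $ i)))) (at (q $ i))"
    by (rule has_derivative_eq_rhs) (simp add: fun_eq_iff if_distrib[of "\<lambda>z. z \<bullet> _"] if_distrib[of "\<lambda>z. _ * z"] cong: if_cong)
qed

lemma gradient_cc_fun:
  fixes q :: "('n::{finite,linorder}) config"
  assumes "q \<notin> collision_set"
  shows "gradient (cc_fun \<alpha> m) q = (\<chi> i. m i *\<^sub>R cc_field \<alpha> m q $ i)"
proof (rule gradient_eqI)
  have nth: "((\<lambda>q. q $ i \<bullet> q $ i) has_derivative (\<lambda>h. 2 * (q $ i \<bullet> h $ i))) (at q)" for i
    by (rule has_derivative_compose[OF bounded_linear_imp_has_derivative[OF bounded_linear_vec_nth]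
        has_derivative_inner_self])
  have "(moment_of_inertia m has_derivative (\<lambda>h. \<Sum>i\<in>UNIV. m i * (2 * (q $ i \<bullet> h $ i)))) (at q)"
    unfolding moment_of_inertia_def[abs_def] power2_norm_eq_inner
    by (intro has_derivative_sum has_derivative_mult_right nth)
  from has_derivative_add[OF has_derivative_potential[OF assms] has_derivative_mult_right[OF this, of "1/2"]]
  show "(cc_fun \<alpha> m has_derivative (\<lambda>h. h \<bullet> (\<chi> i. m i *\<^sub>R cc_field \<alpha> m q $ i))) (at q)"
    unfolding cc_fun_def[abs_def]
    by (rule has_derivative_eq_rhs)
      (simp add: fun_eq_iff inner_vec_def[where 'b = 'n] sum_distrib_left inner_diff_right inner_commute
        sum.distrib[symmetric] algebra_simps)
qed

lemma has_derivative_cc_field: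
  fixes q :: "('n::{finite,linorder}) config"
  assumes "q \<notin> collision_set"
  shows "(cc_field \<alpha> m has_derivative dcc_field \<alpha> m q) (at q)"
proof -
  have "((\<lambda>q. force \<alpha> (q $ i - q $ j)) has_derivative (\<lambda>h. dforce \<alpha> (q $ i - q $ j) (h $ i - h $ j))) (at q)" for i j
  proof (cases "i = j")
    case False
    then have "q $ i - q $ j \<noteq> 0" using assms by (simp add: notin_collision_set)
    from has_derivative_compose[OF has_derivative_vec_nth_diff has_derivative_force[OF this]] show ?thesis .
  qed simp
  then show ?thesis
    unfolding cc_field_def[abs_def] dcc_field_def
    by (intro has_derivative_vec_lambda has_derivative_diff has_derivative_sum has_derivative_scaleR_right
      bounded_linear_imp_has_derivative bounded_linear_vec_nth)
qed

lemma hessian_cc_fun: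
  fixes q :: "('n::{finite,linorder}) config"
  assumes "q \<notin> collision_set"
  shows "hessian (cc_fun \<alpha> m) q = (\<lambda>h. \<chi> i. m i *\<^sub>R dcc_field \<alpha> m q h $ i)"
proof -
  have "((\<lambda>q. \<chi> i. m i *\<^sub>R cc_field \<alpha> m q $ i) has_derivative (\<lambda>h. \<chi> i. m i *\<^sub>R dcc_field \<alpha> m q h $ i)) (at q)"
    by (intro has_derivative_vec_lambda has_derivative_scaleR_right
      has_derivative_compose[OF has_derivative_cc_field[OF assms]]
      bounded_linear_imp_has_derivative bounded_linear_vec_nth)
  \<comment> \<open>The formula for the gradient is known only off the collision set; openness of
    that region suffices to differentiate it.\<close>
  then have "(gradient (cc_fun \<alpha> m) has_derivative (\<lambda>h. \<chi> i. m i *\<^sub>R dcc_field \<alpha> m q h $ i)) (at q)"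
    by (rule has_derivative_transform_within_open[OF _ open_noncollision])
       (use assms in \<open>auto simp: gradient_cc_fun\<close>)
  then show ?thesis unfolding hessian_def by (rule frechet_derivative_at[symmetric])
qed

text \<open>With center of mass 0 and multiplier 1, the defining equation reads
  \<open>- m i * (cc_field - q) = m i * q\<close> in each component, and the terms in
  \<open>q\<close> cancel.\<close>

lemma normalised_cc_imp_cc_field:
  fixes q :: "('n::{finite,linorder}) config"
  assumes "normalised_cc \<alpha> m q" "\<And>i. m i \<noteq> 0"
  shows "q \<notin> collision_set" "cc_field \<alpha> m q = 0"
  using assms
  by (auto simp: normalised_cc_def central_configuration_def partial_gradient_potential vec_eq_iff
      algebra_simps)

section \<open>Plane rotations and the equivariance of the field\<close>

definition rot90 :: "real^2 \<Rightarrow> real^2" where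
  "rot90 p = vector [- p $ 2, p $ 1]"

lemma rot90_nth [simp]: "rot90 p $ 1 = - p $ 2" "rot90 p $ 2 = p $ 1"
  by (simp_all add: rot90_def)

lemma inner_real2: "p \<bullet> q = p $ 1 * q $ 1 + p $ 2 * q $ 2" for p q :: "real^2"
  by (simp add: inner_vec_def sum_2)

text \<open>Multiplication by the complex number \<open>a + b i\<close>, a rotation when
  \<open>a\<^sup>2 + b\<^sup>2 = 1\<close>.\<close>

definition rot :: "real \<Rightarrow> real \<Rightarrow> real^2 \<Rightarrow> real^2" where
  "rot a b p = a *\<^sub>R p + b *\<^sub>R rot90 p"

lemma rot_linear: "linear (rot a b)"
  by (rule linearI) (simp_all add: rot_def vec_eq_iff forall_2 algebra_simps)

lemma rot_rot90: "rot a b (rot90 p) = rot90 (rot a b p)"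
  by (simp add: rot_def vec_eq_iff forall_2 algebra_simps)

lemma rot_inner: "a\<^sup>2 + b\<^sup>2 = 1 \<Longrightarrow> rot a b p \<bullet> rot a b q = p \<bullet> q"
proof -
  assume "a\<^sup>2 + b\<^sup>2 = 1"
  moreover have "rot a b p \<bullet> rot a b q = (a\<^sup>2 + b\<^sup>2) * (p \<bullet> q)"
    by (simp add: rot_def inner_real2 algebra_simps power2_eq_square)
  ultimately show ?thesis by simp
qed

lemma rot_inverse: "a\<^sup>2 + b\<^sup>2 = 1 \<Longrightarrow> rot a b (rot a (- b) p) = p"
proof -
  assume "a\<^sup>2 + b\<^sup>2 = 1"
  moreover have "rot a b (rot a (- b) p) = (a\<^sup>2 + b\<^sup>2) *\<^sub>R p"
    by (simp add: rot_def vec_eq_iff forall_2 algebra_simps power2_eq_square)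
  ultimately show ?thesis by simp
qed

definition rot_config :: "real \<Rightarrow> real \<Rightarrow> 'n::finite config \<Rightarrow> 'n config" where
  "rot_config a b q = (\<chi> i. rot a b (q $ i))"

lemma rot_force:
  assumes "a\<^sup>2 + b\<^sup>2 = 1"
  shows "force \<alpha> (rot a b p) = rot a b (force \<alpha> p)"
    "dforce \<alpha> (rot a b p) (rot a b h) = rot a b (dforce \<alpha> p h)"
  using assms
  by (simp_all add: force_def dforce_def rot_inner linear_add[OF rot_linear] linear_cmul[OF rot_linear])

lemma rot_cc_field:
  assumes "a\<^sup>2 + b\<^sup>2 = 1"
  shows "cc_field \<alpha> m (rot_config a b q) = rot_config a b (cc_field \<alpha> m q)"
    "dcc_field \<alpha> m (rot_config a b q) (rot_config a b h) = rot_config a b (dcc_field \<alpha> m q h)"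
  unfolding cc_field_def dcc_field_def rot_config_def
  by (intro vec_eq_iff[THEN iffD2] allI; simp add: rot_force[OF assms]
      flip: linear_diff[OF rot_linear] linear_sum[OF rot_linear] linear_cmul[OF rot_linear])+

section \<open>Rotations\<close>

lemma rot90_diff: "rot90 (p - q) = rot90 p - rot90 q"
  by (simp add: vec_eq_iff forall_2)

lemma inner_rot90: "p \<bullet> rot90 q = - (q \<bullet> rot90 p)"
  by (simp add: inner_real2)

lemma inner_rot90_self [simp]: "p \<bullet> rot90 p = 0"
  by (simp add: inner_real2)

text \<open>Exchanging \<open>i\<close> and \<open>j\<close> shows that the sum with
  \<open>u j\<close> in place of \<open>u i\<close> is the negative of the given one; so taking the
  difference doubles it.\<close>

lemma sum_antisym_inner_rot90:
  fixes F :: "'n::finite \<Rightarrow> 'n \<Rightarrow> real^2"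
  assumes c: "\<And>i j. c i j = c j i" and F: "\<And>i j. F j i = - F i j"
  shows "(\<Sum>i\<in>UNIV. \<Sum>j\<in>UNIV. c i j * (F i j \<bullet> rot90 (u i))) =
    (\<Sum>i\<in>UNIV. \<Sum>j\<in>UNIV. c i j * (F i j \<bullet> rot90 (u i - u j))) / 2"
proof -
  let ?S = "\<Sum>i\<in>UNIV. \<Sum>j\<in>UNIV. c i j * (F i j \<bullet> rot90 (u i))"
  have "(\<Sum>i\<in>UNIV. \<Sum>j\<in>UNIV. c i j * (F i j \<bullet> rot90 (u j))) =
      (\<Sum>j\<in>UNIV. \<Sum>i\<in>UNIV. c i j * (F i j \<bullet> rot90 (u j)))" by (rule sum.swap)
  also have "\<dots> = (\<Sum>j\<in>UNIV. \<Sum>i\<in>UNIV. - (c j i * (F j i \<bullet> rot90 (u j))))"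
  proof (intro sum.cong refl)
    show "c i j * (F i j \<bullet> rot90 (u j)) = - (c j i * (F j i \<bullet> rot90 (u j)))" for i j
      using c[of i j] F[of j i] by simp
  qed
  also have "\<dots> = - ?S" by (simp add: sum_negf)
  finally have "(\<Sum>i\<in>UNIV. \<Sum>j\<in>UNIV. c i j * (F i j \<bullet> rot90 (u j))) = - ?S" .
  then have "(\<Sum>i\<in>UNIV. \<Sum>j\<in>UNIV. c i j * (F i j \<bullet> rot90 (u i - u j))) = 2 * ?S"
    by (simp add: rot90_diff inner_diff_right right_diff_distrib sum_subtractf)
  then show ?thesis by simp
qed

text \<open>Differentiating the identity \<open>\<Sum>i. m i * (cc_field \<alpha> m q $ i \<bullet> rot90 (q $ i)) = 0\<close>, which
  expresses the rotation invariance of the potential: one equation of the system is redundant.\<close>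

lemma dcc_field_inner_rot90:
  assumes "cc_field \<alpha> m q = 0"
  shows "(\<Sum>i\<in>UNIV. m i * (dcc_field \<alpha> m q h $ i \<bullet> rot90 (q $ i))) = 0"
proof -
  let ?c = "\<lambda>i j. newton_coeff \<alpha> * m i * m j"
  let ?s = "\<lambda>i j. ((q $ i - q $ j) \<bullet> (q $ i - q $ j)) powr newton_exp \<alpha>"
  let ?X = "\<lambda>i j. ?c i j * (?s i j * ((h $ i - h $ j) \<bullet> rot90 (q $ i - q $ j)))"
  have f: "force \<alpha> (q $ j - q $ i) = - force \<alpha> (q $ i - q $ j)" for i j
    using force_minus[of \<alpha> "q $ i - q $ j"] by simp
  have df: "dforce \<alpha> (q $ j - q $ i) (h $ j - h $ i) = - dforce \<alpha> (q $ i - q $ j) (h $ i - h $ j)" for i j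
    using dforce_minus[of \<alpha> "q $ i - q $ j" "h $ i - h $ j"] by simp
  have "(\<Sum>i\<in>UNIV. m i * (dcc_field \<alpha> m q h $ i \<bullet> rot90 (q $ i))) =
     (\<Sum>i\<in>UNIV. m i * (h $ i \<bullet> rot90 (q $ i))) -
     (\<Sum>i\<in>UNIV. \<Sum>j\<in>UNIV. ?c i j * (dforce \<alpha> (q $ i - q $ j) (h $ i - h $ j) \<bullet> rot90 (q $ i)))"
    by (simp add: dcc_field_def inner_diff_left inner_sum_left right_diff_distrib sum_subtractf
        sum_distrib_left mult_ac)
  also have "(\<Sum>i\<in>UNIV. \<Sum>j\<in>UNIV. ?c i j * (dforce \<alpha> (q $ i - q $ j) (h $ i - h $ j) \<bullet> rot90 (q $ i)))
    = (\<Sum>i\<in>UNIV. \<Sum>j\<in>UNIV. ?c i j * (dforce \<alpha> (q $ i - q $ j) (h $ i - h $ j) \<bullet> rot90 (q $ i - q $ j))) / 2"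
    by (rule sum_antisym_inner_rot90[OF _ df]) simp
  \<comment> \<open>The part of \<open>dforce\<close> along \<open>q $ i - q $ j\<close> is
    orthogonal to the rotated difference and drops out.\<close>
  also have "\<dots> = (\<Sum>i\<in>UNIV. \<Sum>j\<in>UNIV. ?X i j) / 2"
    by (simp add: dforce_def inner_add_left)
  finally have 1: "(\<Sum>i\<in>UNIV. m i * (dcc_field \<alpha> m q h $ i \<bullet> rot90 (q $ i))) =
     (\<Sum>i\<in>UNIV. m i * (h $ i \<bullet> rot90 (q $ i))) - (\<Sum>i\<in>UNIV. \<Sum>j\<in>UNIV. ?X i j) / 2" .
  \<comment> \<open>Pairing the equation itself with the rotated \<open>h\<close> produces the
    negative of the right-hand side of \<open>1\<close>, because \<open>p \<bullet> rot90 q\<close>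
    is antisymmetric.\<close>
  have "0 = (\<Sum>i\<in>UNIV. m i * (cc_field \<alpha> m q $ i \<bullet> rot90 (h $ i)))" by (simp add: assms)
  also have "\<dots> = (\<Sum>i\<in>UNIV. m i * (q $ i \<bullet> rot90 (h $ i))) -
     (\<Sum>i\<in>UNIV. \<Sum>j\<in>UNIV. ?c i j * (force \<alpha> (q $ i - q $ j) \<bullet> rot90 (h $ i)))"
    by (simp add: cc_field_def inner_diff_left inner_sum_left right_diff_distrib sum_subtractf
        sum_distrib_left mult_ac)
  also have "(\<Sum>i\<in>UNIV. \<Sum>j\<in>UNIV. ?c i j * (force \<alpha> (q $ i - q $ j) \<bullet> rot90 (h $ i)))
    = (\<Sum>i\<in>UNIV. \<Sum>j\<in>UNIV. ?c i j * (force \<alpha> (q $ i - q $ j) \<bullet> rot90 (h $ i - h $ j))) / 2"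
    by (rule sum_antisym_inner_rot90[OF _ f]) simp
  also have "\<dots> = (\<Sum>i\<in>UNIV. \<Sum>j\<in>UNIV. - ?X i j) / 2"
  proof (rule arg_cong[where f = "\<lambda>z. z / 2"], intro sum.cong refl)
    show "?c i j * (force \<alpha> (q $ i - q $ j) \<bullet> rot90 (h $ i - h $ j)) = - ?X i j" for i j
      by (subst inner_rot90) (simp add: force_def inner_rot90[of "q $ i - q $ j" "h $ i - h $ j"] inner_commute
          linear_cmul[OF rot_linear])
  qed
  also have "(\<Sum>i\<in>UNIV. m i * (q $ i \<bullet> rot90 (h $ i))) = - (\<Sum>i\<in>UNIV. m i * (h $ i \<bullet> rot90 (q $ i)))"
    by (subst inner_rot90) (simp add: sum_negf)
  finally show ?thesis unfolding 1 by (simp add: sum_negf)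
qed

lemma rotation_matrix_eq_rot:
  assumes "rotation_matrix R"
  shows "\<exists>a b. a\<^sup>2 + b\<^sup>2 = 1 \<and> (\<forall>p. R *v p = rot a b p)"
proof -
  have o: "transpose R ** R = mat 1" and d: "det R = 1"
    using assms by (simp_all add: rotation_matrix_def orthogonal_matrix)
  have e: "R$1$1 * R$1$1 + R$2$1 * R$2$1 = 1" "R$1$2 * R$1$2 + R$2$2 * R$2$2 = 1"
    using arg_cong[OF o, of "\<lambda>A. A$1$1"] arg_cong[OF o, of "\<lambda>A. A$2$2"]
    by (simp_all add: matrix_matrix_mult_def sum_2 transpose_def mat_def)
  \<comment> \<open>The left-hand side is the sum of the squared entries, which is 2, minus twice
    the determinant.\<close>
  have "(R$2$2 - R$1$1)\<^sup>2 + (R$1$2 + R$2$1)\<^sup>2 = 0"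
    using e d by (simp add: det_2 power2_eq_square algebra_simps)
  then have "R$2$2 = R$1$1" "R$1$2 = - R$2$1" by (simp_all add: sum_power2_eq_zero_iff)
  then have "R *v p = rot (R$1$1) (R$2$1) p" for p
    by (simp add: vec_eq_iff forall_2 matrix_vector_mult_def sum_2 rot_def)
  moreover have "(R$1$1)\<^sup>2 + (R$2$1)\<^sup>2 = 1" using e by (simp add: power2_eq_square)
  ultimately show ?thesis by blast
qed

text \<open>A curve in the orbit is \<open>rot (a t) (b t)\<close> applied to \<open>q\<close>.
  Inner products with the nonzero vectors \<open>q $ k\<close> and \<open>rot90 (q $ k)\<close>
  recover \<open>a\<close> and \<open>b\<close>, which are therefore differentiable at 0;
  differentiating \<open>a\<^sup>2 + b\<^sup>2 = 1\<close> at \<open>(1, 0)\<close> leaves only the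
  \<open>rot90\<close> direction.\<close>

lemma tangent_space_SO2_orbit:
  fixes q :: "'n::finite config"
  assumes v: "v \<in> tangent_space (SO2_orbit q) q" and k: "q $ k \<noteq> 0"
  shows "\<exists>c. \<forall>i. v $ i = c *\<^sub>R rot90 (q $ i)"
proof -
  from v obtain \<gamma> where \<gamma>: "range \<gamma> \<subseteq> SO2_orbit q" "\<gamma> 0 = q" "(\<gamma> has_vector_derivative v) (at 0)"
    unfolding tangent_space_def by blast
  have "\<exists>a b. a\<^sup>2 + b\<^sup>2 = 1 \<and> (\<forall>i. \<gamma> t $ i = rot a b (q $ i))" for t
  proof -
    have "\<gamma> t \<in> SO2_orbit q" using \<gamma>(1) by blast
    then obtain R where R: "\<gamma> t = diag_act R q" "rotation_matrix R" unfolding SO2_orbit_def by blast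
    show ?thesis using rotation_matrix_eq_rot[OF R(2)] unfolding R(1) diag_act_def by auto
  qed
  then obtain a b where ab: "\<And>t. (a t)\<^sup>2 + (b t)\<^sup>2 = 1" "\<And>t i. \<gamma> t $ i = rot (a t) (b t) (q $ i)"
    by metis
  let ?n = "q $ k \<bullet> q $ k"
  have n: "?n \<noteq> 0" using k by simp
  have rr: "rot90 p \<bullet> rot90 p = p \<bullet> p" "rot90 p \<bullet> p = 0" for p by (simp_all add: inner_real2)
  have a: "a t = (\<gamma> t $ k \<bullet> q $ k) / ?n" and b: "b t = (\<gamma> t $ k \<bullet> rot90 (q $ k)) / ?n" for t
    using n by (simp_all add: ab(2) rot_def inner_add_left rr)
  have nth: "((\<lambda>t. \<gamma> t $ i) has_vector_derivative v $ i) (at 0)" for i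
    using bounded_linear.has_vector_derivative[OF bounded_linear_vec_nth \<gamma>(3)] .
  define a' where "a' = (v $ k \<bullet> q $ k) / ?n"
  define b' where "b' = (v $ k \<bullet> rot90 (q $ k)) / ?n"
  have inn: "((\<lambda>t. \<gamma> t $ k \<bullet> w) has_vector_derivative v $ k \<bullet> w) (at 0)" for w
    using bounded_linear.has_vector_derivative[OF bounded_linear_inner_left nth] .
  have da: "(a has_real_derivative a') (at 0)" and db: "(b has_real_derivative b') (at 0)"
    using inn[of "q $ k"] inn[of "rot90 (q $ k)"]
    unfolding a[abs_def] b[abs_def] a'_def b'_def
    by (auto simp: has_real_derivative_iff_has_vector_derivative[symmetric] intro!: DERIV_cdivide)
  have a0: "a 0 = 1" and b0: "b 0 = 0" using n by (simp_all add: a b \<gamma>(2) del: rot90_nth)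
  have "((\<lambda>t. (a t)\<^sup>2 + (b t)\<^sup>2) has_real_derivative 2 * a 0 * a' + 2 * b 0 * b') (at 0)"
    by (auto intro!: derivative_eq_intros da db)
  moreover have "((\<lambda>t. (a t)\<^sup>2 + (b t)\<^sup>2) has_real_derivative 0) (at 0)" by (simp add: ab(1))
  ultimately have "a' = 0" using DERIV_unique a0 b0 by fastforce
  have "v $ i = b' *\<^sub>R rot90 (q $ i)" for i
  proof -
    have "((\<lambda>t. rot (a t) (b t) (q $ i)) has_vector_derivative a' *\<^sub>R q $ i + b' *\<^sub>R rot90 (q $ i)) (at 0)"
      unfolding rot_def
      by (intro has_vector_derivative_add bounded_linear.has_vector_derivative[OF bounded_linear_scaleR_left])
         (use da db in \<open>simp_all add: has_real_derivative_iff_has_vector_derivative\<close>)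
    with nth[of i] show ?thesis
      unfolding ab(2) using \<open>a' = 0\<close> vector_derivative_unique_at by fastforce
  qed
  then show ?thesis by blast
qed

section \<open>Orbits and the choice of a representative\<close>

lemma O2_orbit_diag_act:
  fixes q :: "'n::finite config"
  assumes R: "orthogonal_matrix R"
  shows "O2_orbit (diag_act R q) = O2_orbit q"
proof -
  have act: "diag_act S (diag_act T p) = diag_act (S ** T) p" for S T and p :: "'n config"
    by (simp add: diag_act_def matrix_vector_mul_assoc)
  have sub: "O2_orbit (diag_act S p) \<subseteq> O2_orbit p" if "orthogonal_matrix S" for S and p :: "'n config"
    using that by (auto simp: O2_orbit_def act intro: orthogonal_matrix_mul)
  have "diag_act (transpose R) (diag_act R q) = q"
    using R by (simp add: act orthogonal_matrix) (simp add: diag_act_def)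
  then show ?thesis
    using sub[OF R, of q] sub[of "transpose R" "diag_act R q"] R orthogonal_matrix_transpose by auto
qed

lemma O2_orbit_rot_config:
  assumes "a\<^sup>2 + b\<^sup>2 = 1"
  shows "O2_orbit (rot_config a b q) = O2_orbit q"
proof -
  define R :: "real^2^2" where "R = vector [vector [a, - b], vector [b, a]]"
  have "rot_config a b q = diag_act R q"
    by (simp add: rot_config_def diag_act_def vec_eq_iff forall_2 matrix_vector_mult_def sum_2 rot_def R_def)
  moreover have "orthogonal_matrix R"
    using assms unfolding orthogonal_matrix
    by (simp add: vec_eq_iff forall_2 matrix_matrix_mult_def sum_2 transpose_def mat_def R_def power2_eq_square)
  ultimately show ?thesis using O2_orbit_diag_act by simp
qed

text \<open>A representative with body \<open>k\<close> on the first axis, away from the origin.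
  Several representatives of one class may qualify, which does no harm to an upper bound.\<close>

definition gauged_cc :: "real \<Rightarrow> ('n::{finite,linorder} \<Rightarrow> real) \<Rightarrow> 'n \<Rightarrow> 'n config \<Rightarrow> bool" where
  "gauged_cc \<alpha> m k q \<longleftrightarrow> q \<notin> collision_set \<and> cc_field \<alpha> m q = 0 \<and> q $ k $ 2 = 0 \<and> q $ k $ 1 \<noteq> 0 \<and>
     (\<forall>h. dcc_field \<alpha> m q h = 0 \<longrightarrow> (\<exists>c. \<forall>i. h $ i = c *\<^sub>R rot90 (q $ i)))"

lemma nondegenerate_cc_classes_subset:
  fixes m :: "'n::{finite,linorder} \<Rightarrow> real"
  assumes n: "CARD('n) \<ge> 2" and m: "\<And>i. m i \<noteq> 0"
  shows "nondegenerate_cc_classes \<alpha> m \<subseteq> (\<Union>k. O2_orbit ` {q. gauged_cc \<alpha> m k q})"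
proof
  fix X assume "X \<in> nondegenerate_cc_classes \<alpha> m"
  then obtain q where X: "X = O2_orbit q" and q: "normalised_cc \<alpha> m q" "nondegenerate \<alpha> m q"
    unfolding nondegenerate_cc_classes_def by blast
  note cc = normalised_cc_imp_cc_field[OF q(1) m]
  have "\<exists>k. q $ k \<noteq> 0"
  proof (rule ccontr)
    assume "\<not> ?thesis"
    then have "i = j" for i j :: 'n using cc(1) unfolding notin_collision_set by metis
    then have "CARD('n) \<le> 1" by (metis UNIV_I card_le_Suc0_iff_eq finite One_nat_def)
    with n show False by simp
  qed
  then obtain k where k: "q $ k \<noteq> 0" by blast
  have ker: "\<exists>c. \<forall>i. h $ i = c *\<^sub>R rot90 (q $ i)" if "dcc_field \<alpha> m q h = 0" for h
  proof -
    have "hessian (cc_fun \<alpha> m) q h = 0" using that cc(1) by (simp add: hessian_cc_fun vec_eq_iff)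
    then have "h \<in> tangent_space (SO2_orbit q) q" using q(2) unfolding nondegenerate_def by blast
    then show ?thesis using k by (rule tangent_space_SO2_orbit)
  qed
  \<comment> \<open>The complex conjugate of \<open>q $ k\<close>, divided by its norm:
    multiplication by it turns \<open>q $ k\<close> onto the positive first axis.\<close>
  define a where "a = q $ k $ 1 / norm (q $ k)"
  define b where "b = - q $ k $ 2 / norm (q $ k)"
  have "norm (q $ k) > 0" using k by simp
  moreover have "(q $ k $ 1)\<^sup>2 + (q $ k $ 2)\<^sup>2 = (norm (q $ k))\<^sup>2"
    unfolding power2_norm_eq_inner inner_real2 by (simp add: power2_eq_square)
  ultimately have nk: "norm (q $ k) > 0" "(q $ k $ 1)\<^sup>2 + (q $ k $ 2)\<^sup>2 = (norm (q $ k))\<^sup>2" .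
  then have ab: "a\<^sup>2 + b\<^sup>2 = 1"
    by (simp add: a_def b_def power_divide flip: add_divide_distrib)
  let ?q = "rot_config a b q"
  have inv: "rot_config a b (rot_config a (- b) h) = h" for h :: "'n config"
    by (simp add: rot_config_def vec_eq_iff rot_inverse[OF ab])
  have rinj: "rot a b p = rot a b p' \<longleftrightarrow> p = p'" for p p'
    using rot_inverse[of a "- b"] ab by (metis minus_minus power2_minus)
  have "gauged_cc \<alpha> m k ?q"
    unfolding gauged_cc_def
  proof (intro conjI allI impI)
    show "?q \<notin> collision_set" using cc(1) by (simp add: notin_collision_set rot_config_def rinj)
    show "cc_field \<alpha> m ?q = 0"
      by (simp add: rot_cc_field[OF ab] cc(2)) (simp add: rot_config_def rot_def vec_eq_iff forall_2)
    show "?q $ k $ 2 = 0"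
      by (simp add: rot_config_def rot_def a_def b_def)
    have "?q $ k $ 1 = ((q $ k $ 1)\<^sup>2 + (q $ k $ 2)\<^sup>2) / norm (q $ k)"
      by (simp add: rot_config_def rot_def a_def b_def power2_eq_square add_divide_distrib)
    then show "?q $ k $ 1 \<noteq> 0" using nk by simp
  next
    fix h assume h: "dcc_field \<alpha> m ?q h = 0"
    let ?h = "rot_config a (- b) h"
    have "rot_config a b (dcc_field \<alpha> m q ?h) = 0"
      using h rot_cc_field(2)[OF ab, of \<alpha> m q ?h] by (simp add: inv)
    moreover have "rot a b p = 0 \<Longrightarrow> p = 0" for p
      using rinj[of p 0] by (simp add: rot_def vec_eq_iff forall_2)
    ultimately have "dcc_field \<alpha> m q ?h = 0" by (simp add: rot_config_def vec_eq_iff[where 'b = 'n])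
    from ker[OF this] obtain c where c: "\<And>i. ?h $ i = c *\<^sub>R rot90 (q $ i)" by blast
    have "h $ i = c *\<^sub>R rot90 (?q $ i)" for i
    proof -
      have "h $ i = rot a b (?h $ i)" using inv[of h] by (metis rot_config_def vec_lambda_beta)
      also have "\<dots> = c *\<^sub>R rot90 (?q $ i)"
        by (simp add: c linear_cmul[OF rot_linear] rot_rot90) (simp add: rot_config_def)
      finally show ?thesis .
    qed
    then show "\<exists>c. \<forall>i. h $ i = c *\<^sub>R rot90 (?q $ i)" by blast
  qed
  moreover have "X = O2_orbit ?q" using X O2_orbit_rot_config[OF ab, of q] by simp
  ultimately show "X \<in> (\<Union>k. O2_orbit ` {q. gauged_cc \<alpha> m k q})" by blast
qed

section \<open>The system of equations for central configurations\<close>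

text \<open>The type indexes the unknowns and also the equations, so the system is square by
  construction. Logarithms and weights exist for all ordered pairs; the diagonal ones are set to 0
  by equations of their own.\<close>

datatype 'n cvar = Pos 'n "2" | Lg 'n 'n | Wt 'n 'n | Slack

instance cvar :: (finite) finite
proof
  let ?P = "(\<lambda>p. Pos (fst p) (snd p)) ` (UNIV :: ('a \<times> 2) set)"
  let ?L = "(\<lambda>p. Lg (fst p) (snd p)) ` (UNIV :: ('a \<times> 'a) set)"
  let ?W = "(\<lambda>p. Wt (fst p) (snd p)) ` (UNIV :: ('a \<times> 'a) set)"
  have "UNIV \<subseteq> ?P \<union> ?L \<union> ?W \<union> {Slack}"
  proof
    fix x :: "'a cvar"
    have "Pos i c \<in> ?P" "Lg i j \<in> ?L" "Wt i j \<in> ?W" for i j c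
      by (rule image_eqI[of _ _ "(i, c)"], simp, simp)
         (rule image_eqI[of _ _ "(i, j)"], simp, simp)+
    then show "x \<in> ?P \<union> ?L \<union> ?W \<union> {Slack}" by (cases x) simp_all
  qed
  then show "finite (UNIV :: 'a cvar set)" by (rule finite_subset) simp
qed

text \<open>An arbitrary well-order, needed only because the library's Sard theorem asks for one.\<close>

definition cvar_index :: "'a::finite cvar \<Rightarrow> nat" where
  "cvar_index = (SOME f. inj f)"

lemma inj_cvar_index: "inj (cvar_index :: 'a::finite cvar \<Rightarrow> nat)"
  unfolding cvar_index_def
  using finite_imp_inj_to_nat_seg[of "UNIV :: 'a cvar set"] by (intro someI_ex[of inj]) blast

instantiation cvar :: (finite) wellorder
begin

definition less_eq_cvar :: "'a cvar \<Rightarrow> 'a cvar \<Rightarrow> bool" where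
  "less_eq_cvar x y \<longleftrightarrow> cvar_index x \<le> cvar_index y"

definition less_cvar :: "'a cvar \<Rightarrow> 'a cvar \<Rightarrow> bool" where
  "less_cvar x y \<longleftrightarrow> cvar_index x < cvar_index y"

instance
proof
  fix x y z :: "'a cvar"
  show "x < y \<longleftrightarrow> x \<le> y \<and> \<not> y \<le> x" unfolding less_eq_cvar_def less_cvar_def by linarith
  show "x \<le> x" unfolding less_eq_cvar_def by (rule order_refl)
  show "x \<le> z" if "x \<le> y" "y \<le> z" using that unfolding less_eq_cvar_def by linarith
  show "x \<le> y \<or> y \<le> x" unfolding less_eq_cvar_def by linarith
  show "x = y" if "x \<le> y" "y \<le> x"
  proof (rule injD[OF inj_cvar_index])
    show "cvar_index x = cvar_index y" using that unfolding less_eq_cvar_def by linarith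
  qed
next
  fix P :: "'a cvar \<Rightarrow> bool" and a :: "'a cvar"
  assume step: "\<And>x. (\<And>y. y < x \<Longrightarrow> P y) \<Longrightarrow> P x"
  show "P a"
  proof (induction a rule: measure_induct_rule[of cvar_index])
    case (less x)
    show ?case by (rule step, rule less.IH) (simp only: less_cvar_def)
  qed
qed

end

text \<open>Row \<open>Pos k 2\<close> carries the gauge condition in place of the redundant
  component of the equation of body \<open>k\<close>.\<close>

definition cc_poly :: "real \<Rightarrow> ('n::finite \<Rightarrow> real) \<Rightarrow> 'n \<Rightarrow> 'n cvar \<Rightarrow> real^'n cvar \<Rightarrow> real" where
  "cc_poly \<alpha> m k v x = (case v of
      Pos i c \<Rightarrow> if i = k \<and> c = 2 then x $ Pos i c
        else x $ Pos i c - (\<Sum>j\<in>UNIV. newton_coeff \<alpha> * m j * (x $ Wt i j * (x $ Pos i c - x $ Pos j c)))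
    | Lg i j \<Rightarrow> if i = j then x $ Lg i j else (\<Sum>c\<in>UNIV. (x $ Pos i c - x $ Pos j c)\<^sup>2)
    | Wt i j \<Rightarrow> x $ Wt i j
    | Slack \<Rightarrow> (norm x)\<^sup>2)"

text \<open>Off the diagonal, the resulting rows say that the squared distance times
  \<open>exp (- L)\<close> is 1 and that \<open>W * exp (- newton_exp \<alpha> * L)\<close> is 1,
  where \<open>L\<close> and \<open>W\<close> are the variables \<open>Lg i j\<close> and
  \<open>Wt i j\<close>.\<close>

definition cc_rate :: "real \<Rightarrow> 'n cvar \<Rightarrow> real" where
  "cc_rate \<alpha> v = (case v of Lg i j \<Rightarrow> if i = j then 0 else 1
    | Wt i j \<Rightarrow> if i = j then 0 else newton_exp \<alpha> | _ \<Rightarrow> 0)"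

definition cc_arg :: "'n cvar \<Rightarrow> 'n cvar" where
  "cc_arg v = (case v of Wt i j \<Rightarrow> Lg i j | _ \<Rightarrow> v)"

definition cc_rhs :: "real \<Rightarrow> 'n cvar \<Rightarrow> real" where
  "cc_rhs R v = (case v of Pos i c \<Rightarrow> 0 | Lg i j \<Rightarrow> if i = j then 0 else 1
    | Wt i j \<Rightarrow> if i = j then 0 else 1 | Slack \<Rightarrow> R)"

definition cc_point :: "real \<Rightarrow> real \<Rightarrow> 'n::finite config \<Rightarrow> real^'n cvar" where
  "cc_point \<alpha> z q = (\<chi> v. case v of Pos i c \<Rightarrow> q $ i $ c
    | Lg i j \<Rightarrow> if i = j then 0 else ln ((q $ i - q $ j) \<bullet> (q $ i - q $ j))
    | Wt i j \<Rightarrow> if i = j then 0 else ((q $ i - q $ j) \<bullet> (q $ i - q $ j)) powr newton_exp \<alpha>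
    | Slack \<Rightarrow> z)"

lemma cc_point_nth [simp]:
  "cc_point \<alpha> z q $ Pos i c = q $ i $ c"
  "cc_point \<alpha> z q $ Lg i j = (if i = j then 0 else ln ((q $ i - q $ j) \<bullet> (q $ i - q $ j)))"
  "cc_point \<alpha> z q $ Wt i j = (if i = j then 0 else ((q $ i - q $ j) \<bullet> (q $ i - q $ j)) powr newton_exp \<alpha>)"
  "cc_point \<alpha> z q $ Slack = z"
  by (simp_all add: cc_point_def)

lemma power2_norm_vec: "(norm x)\<^sup>2 = (\<Sum>v\<in>UNIV. (x $ v)\<^sup>2)" for x :: "real^'v"
  unfolding power2_norm_eq_inner inner_vec_def by (simp add: power2_eq_square)

lemma polyd_cc_poly:
  fixes m :: "'n::finite \<Rightarrow> real"
  shows "polyd 2 (cc_poly \<alpha> m k v)"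
proof -
  have sq: "polyd 2 (\<lambda>x. (f x)\<^sup>2)" if "polyd 1 f" for f :: "real^'n cvar \<Rightarrow> real"
    using polyd_power[OF that, of 2] by simp
  have w: "polyd 2 (\<lambda>x. x $ Wt i j * (x $ Pos i c - x $ Pos j c))" for i j :: 'n and c
    by (rule polyd_mult[OF polyd_coord[of 1] polyd_diff[OF polyd_coord[of 1] polyd_coord[of 1]]]) simp_all
  show ?thesis
  proof (cases v)
    case (Pos i c)
    have "polyd 2 (\<lambda>x. x $ Pos i c - (\<Sum>j\<in>UNIV. newton_coeff \<alpha> * m j * (x $ Wt i j * (x $ Pos i c - x $ Pos j c))))"
      by (intro polyd_diff polyd_sum polyd_cmult w polyd_coord) simp
    moreover have "polyd 2 (\<lambda>x. x $ Pos i c)" by (intro polyd_coord) simp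
    ultimately show ?thesis
      by (cases "i = k"; cases "c = 2") (simp_all add: Pos cc_poly_def[abs_def])
  next
    case (Lg i j)
    have "polyd 2 (\<lambda>x. \<Sum>c\<in>UNIV. (x $ Pos i c - x $ Pos j c)\<^sup>2)"
      by (intro polyd_sum sq polyd_diff polyd_coord) simp_all
    moreover have "polyd 2 (\<lambda>x. x $ Lg i j)" by (intro polyd_coord) simp
    ultimately show ?thesis
      by (cases "i = j") (simp_all add: Lg cc_poly_def[abs_def])
  next
    case (Wt i j)
    have "polyd 2 (\<lambda>x. x $ Wt i j)" by (intro polyd_coord) simp
    then show ?thesis by (simp add: Wt cc_poly_def[abs_def])
  next
    case Slack
    have "polyd 2 (\<lambda>x :: real^'n cvar. \<Sum>v\<in>UNIV. (x $ v)\<^sup>2)"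
      by (intro polyd_sum sq polyd_coord) simp_all
    then show ?thesis by (simp add: Slack cc_poly_def[abs_def] power2_norm_vec)
  qed
qed

section \<open>Central configurations as nondegenerate solutions of the system\<close>

lemma newton_exp_nonzero: "\<alpha> \<ge> 0 \<Longrightarrow> newton_exp \<alpha> \<noteq> 0"
  by (simp add: newton_exp_def)

text \<open>The number of exponentials does not vary with \<open>\<alpha>\<close>, so one constant
  serves all exponents.\<close>

lemma cc_rate_support:
  "\<alpha> \<ge> 0 \<Longrightarrow> {v. cc_rate \<alpha> v \<noteq> 0} = {v. \<exists>i j. i \<noteq> j \<and> (v = Lg i j \<or> v = Wt i j)}"
proof (rule Collect_cong)
  fix v :: "'a cvar" assume "\<alpha> \<ge> 0"
  then show "cc_rate \<alpha> v \<noteq> 0 \<longleftrightarrow> (\<exists>i j. i \<noteq> j \<and> (v = Lg i j \<or> v = Wt i j))"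
    by (cases v) (simp_all add: cc_rate_def newton_exp_nonzero)
qed

lemma cc_point_solves:
  assumes q: "gauged_cc \<alpha> m k q"
  shows "exp_system (cc_poly \<alpha> m k) (cc_rate \<alpha>) cc_arg (cc_point \<alpha> z q) =
    (\<chi> v. cc_rhs ((norm (cc_point \<alpha> z q))\<^sup>2) v)"
proof -
  have s: "(q $ i - q $ j) \<bullet> (q $ i - q $ j) > 0" if "i \<noteq> j" for i j
    using q that by (simp add: gauged_cc_def notin_collision_set)
  have f0: "cc_field \<alpha> m q $ i $ c = 0" for i c using q by (simp add: gauged_cc_def)
  have "exp_system (cc_poly \<alpha> m k) (cc_rate \<alpha>) cc_arg (cc_point \<alpha> z q) $ v =
     cc_rhs ((norm (cc_point \<alpha> z q))\<^sup>2) v" for v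
  proof (cases v)
    case (Pos i c)
    have "q $ i $ c - (\<Sum>j\<in>UNIV. newton_coeff \<alpha> * m j * (cc_point \<alpha> z q $ Wt i j * (q $ i $ c - q $ j $ c)))
       = cc_field \<alpha> m q $ i $ c"
      by (auto simp: cc_field_def force_def intro!: sum.cong)
    then show ?thesis using q Pos f0
      by (simp add: exp_system_def cc_poly_def cc_rate_def cc_rhs_def gauged_cc_def del: cc_point_nth(3))
  next
    case (Lg i j)
    show ?thesis
    proof (cases "i = j")
      case False
      have "(\<Sum>c\<in>UNIV. (q $ i $ c - q $ j $ c)\<^sup>2) = (q $ i - q $ j) \<bullet> (q $ i - q $ j)"
        by (simp add: inner_vec_def power2_eq_square)
      then show ?thesis using Lg False s[OF False]
        by (simp add: exp_system_def cc_poly_def cc_rate_def cc_rhs_def cc_arg_def exp_minus)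
    qed (simp add: Lg exp_system_def cc_poly_def cc_rate_def cc_rhs_def)
  next
    case (Wt i j)
    then show ?thesis using s[of i j]
      by (auto simp: exp_system_def cc_poly_def cc_rate_def cc_rhs_def cc_arg_def powr_def simp flip: exp_add)
  next
    case Slack
    then show ?thesis by (simp add: exp_system_def cc_poly_def cc_rate_def cc_rhs_def)
  qed
  then show ?thesis by (simp add: vec_eq_iff)
qed

definition dcc_row :: "real \<Rightarrow> ('n::finite \<Rightarrow> real) \<Rightarrow> 'n \<Rightarrow> real^'n cvar \<Rightarrow> 'n cvar \<Rightarrow> real^'n cvar \<Rightarrow> real" where
  "dcc_row \<alpha> m k x v h = (case v of
      Pos i c \<Rightarrow> if i = k \<and> c = 2 then h $ Pos i c
        else h $ Pos i c - (\<Sum>j\<in>UNIV. newton_coeff \<alpha> * m j *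
          (x $ Wt i j * (h $ Pos i c - h $ Pos j c) + h $ Wt i j * (x $ Pos i c - x $ Pos j c)))
    | Lg i j \<Rightarrow> if i = j then h $ Lg i j
        else exp (- x $ Lg i j) * ((\<Sum>c\<in>UNIV. 2 * (x $ Pos i c - x $ Pos j c) * (h $ Pos i c - h $ Pos j c))
           - (\<Sum>c\<in>UNIV. (x $ Pos i c - x $ Pos j c)\<^sup>2) * h $ Lg i j)
    | Wt i j \<Rightarrow> if i = j then h $ Wt i j
        else exp (- newton_exp \<alpha> * x $ Lg i j) * (h $ Wt i j - x $ Wt i j * (newton_exp \<alpha> * h $ Lg i j))
    | Slack \<Rightarrow> 2 * (x \<bullet> h))"

lemma has_derivative_vec_nth: "((\<lambda>x::('a::real_normed_vector)^'n. x $ i) has_derivative (\<lambda>h. h $ i)) F"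
  by (rule bounded_linear_imp_has_derivative[OF bounded_linear_vec_nth])

lemma has_derivative_cc_system:
  "(exp_system (cc_poly \<alpha> m k) (cc_rate \<alpha>) cc_arg has_derivative (\<lambda>h. \<chi> v. dcc_row \<alpha> m k x v h)) (at x)"
  unfolding exp_system_def[abs_def]
proof (rule has_derivative_vec_lambda)
  note intros = derivative_eq_intros has_derivative_vec_nth
  show "((\<lambda>x. cc_poly \<alpha> m k v x * exp (- cc_rate \<alpha> v * x $ cc_arg v)) has_derivative dcc_row \<alpha> m k x v) (at x)" for v
  proof (cases v)
    case (Pos i c)
    show ?thesis
    proof (cases "i = k \<and> c = 2")
      case False
      then have "(\<lambda>x. cc_poly \<alpha> m k v x * exp (- cc_rate \<alpha> v * x $ cc_arg v)) = (\<lambda>x. x $ Pos i c -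
         (\<Sum>j\<in>UNIV. newton_coeff \<alpha> * m j * (x $ Wt i j * (x $ Pos i c - x $ Pos j c))))"
        "dcc_row \<alpha> m k x v = (\<lambda>h. h $ Pos i c - (\<Sum>j\<in>UNIV. newton_coeff \<alpha> * m j *
          (x $ Wt i j * (h $ Pos i c - h $ Pos j c) + h $ Wt i j * (x $ Pos i c - x $ Pos j c))))"
        unfolding Pos cc_poly_def dcc_row_def cc_rate_def by (auto simp: fun_eq_iff)
      then show ?thesis
        by (simp only:) (intro has_derivative_diff has_derivative_sum has_derivative_mult_right
            has_derivative_mult has_derivative_vec_nth)
    qed (simp add: Pos cc_poly_def[abs_def] dcc_row_def[abs_def] cc_rate_def has_derivative_vec_nth)
  next
    case (Lg i j)
    show ?thesis
    proof (cases "i = j")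
      case False
      then have "(\<lambda>x. cc_poly \<alpha> m k v x * exp (- cc_rate \<alpha> v * x $ cc_arg v)) =
        (\<lambda>x. (\<Sum>c\<in>UNIV. (x $ Pos i c - x $ Pos j c)\<^sup>2) * exp (- x $ Lg i j))"
        unfolding Lg cc_poly_def cc_rate_def cc_arg_def by (auto simp: fun_eq_iff)
      moreover have "((\<lambda>x. (\<Sum>c\<in>UNIV. (x $ Pos i c - x $ Pos j c)\<^sup>2) * exp (- x $ Lg i j)) has_derivative
         dcc_row \<alpha> m k x v) (at x)"
        by (rule intros refl)+
          (use False in \<open>simp add: fun_eq_iff Lg dcc_row_def sum_distrib_left sum_distrib_right sum_negf algebra_simps\<close>)
      ultimately show ?thesis by simp
    qed (simp add: Lg cc_poly_def[abs_def] dcc_row_def[abs_def] cc_rate_def has_derivative_vec_nth)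
  next
    case (Wt i j)
    show ?thesis
    proof (cases "i = j")
      case False
      then have "(\<lambda>x. cc_poly \<alpha> m k v x * exp (- cc_rate \<alpha> v * x $ cc_arg v)) =
        (\<lambda>x. x $ Wt i j * exp (- newton_exp \<alpha> * x $ Lg i j))"
        unfolding Wt cc_poly_def cc_rate_def cc_arg_def by (auto simp: fun_eq_iff)
      moreover have "((\<lambda>x. x $ Wt i j * exp (- newton_exp \<alpha> * x $ Lg i j)) has_derivative
         dcc_row \<alpha> m k x v) (at x)"
        by (rule intros refl)+ (use False in \<open>simp add: fun_eq_iff Wt dcc_row_def algebra_simps\<close>)
      ultimately show ?thesis by simp
    qed (simp add: Wt cc_poly_def[abs_def] dcc_row_def[abs_def] cc_rate_def has_derivative_vec_nth)
  next
    case Slack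
    then show ?thesis
      using has_derivative_inner_self[of x]
      by (simp add: cc_poly_def[abs_def] dcc_row_def[abs_def] cc_rate_def power2_norm_eq_inner)
  qed
qed

text \<open>For a kernel vector, the logarithm and weight rows express those components through the
  displacement \<open>\<eta>\<close> of the bodies. What remains is the linearised field without one
  component; that component is recovered from rotation invariance, and nondegeneracy makes
  \<open>\<eta>\<close> an infinitesimal rotation, which the gauge row excludes.\<close>

lemma nondeg_cc_point:
  fixes m :: "'n::{finite,linorder} \<Rightarrow> real"
  assumes q: "gauged_cc \<alpha> m k q" and z: "z \<noteq> 0" and m: "m k \<noteq> 0"
  shows "nondeg (exp_system (cc_poly \<alpha> m k) (cc_rate \<alpha>) cc_arg) (cc_point \<alpha> z q)"
proof -
  let ?X = "cc_point \<alpha> z q"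
  let ?D = "\<lambda>h. \<chi> v. dcc_row \<alpha> m k ?X v h"
  note der = has_derivative_cc_system[of \<alpha> m k ?X]
  have "h = 0" if "?D h = 0" for h
  proof -
    have row: "dcc_row \<alpha> m k ?X v h = 0" for v using that by (simp add: vec_eq_iff)
    define \<eta> :: "'n config" where "\<eta> = (\<chi> i c. h $ Pos i c)"
    let ?d = "\<lambda>i j. q $ i - q $ j" and ?g = "\<lambda>i j. \<eta> $ i - \<eta> $ j"
    have \<eta>: "h $ Pos i c = \<eta> $ i $ c" for i c by (simp add: \<eta>_def)
    have s: "?d i j \<bullet> ?d i j > 0" if "i \<noteq> j" for i j
      using q that by (simp add: gauged_cc_def notin_collision_set)
    have L: "h $ Lg i j = 2 * (?d i j \<bullet> ?g i j) / (?d i j \<bullet> ?d i j)" if "i \<noteq> j" for i j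
    proof -
      have "(\<Sum>c\<in>UNIV. 2 * ?d i j $ c * ?g i j $ c) = (\<Sum>c\<in>UNIV. (?d i j $ c)\<^sup>2) * h $ Lg i j"
        using row[of "Lg i j"] that by (simp add: dcc_row_def \<eta>)
      moreover have "(\<Sum>c\<in>UNIV. 2 * ?d i j $ c * ?g i j $ c) = 2 * (?d i j \<bullet> ?g i j)"
        by (simp add: inner_vec_def sum_distrib_left algebra_simps)
      moreover have "(\<Sum>c\<in>UNIV. (?d i j $ c)\<^sup>2) = ?d i j \<bullet> ?d i j"
        by (simp add: inner_vec_def power2_eq_square)
      ultimately have "2 * (?d i j \<bullet> ?g i j) = (?d i j \<bullet> ?d i j) * h $ Lg i j" by simp
      then show ?thesis using s[OF that] by (simp add: field_simps)
    qed
    have W: "h $ Wt i j = ?X $ Wt i j * (newton_exp \<alpha> * h $ Lg i j)" if "i \<noteq> j" for i j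
      using row[of "Wt i j"] that by (simp add: dcc_row_def del: cc_point_nth)
    \<comment> \<open>Eliminating the weight and logarithm components by \<open>W\<close> and
      \<open>L\<close> is the chain rule, and returns the derivative of the force.\<close>
    have F: "?X $ Wt i j * ?g i j $ c + h $ Wt i j * ?d i j $ c = dforce \<alpha> (?d i j) (?g i j) $ c" for i j c
    proof (cases "i = j")
      case True
      then show ?thesis using row[of "Wt i j"] by (simp add: dcc_row_def)
    next
      case False
      then show ?thesis by (simp add: W L dforce_def mult_ac add_ac)
    qed
    have dcc: "dcc_field \<alpha> m q \<eta> $ i $ c = 0" if "\<not> (i = k \<and> c = 2)" for i c
    proof -
      have "dcc_row \<alpha> m k ?X (Pos i c) h = \<eta> $ i $ c -
          (\<Sum>j\<in>UNIV. newton_coeff \<alpha> * m j * (?X $ Wt i j * ?g i j $ c + h $ Wt i j * ?d i j $ c))"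
        using that by (auto simp: dcc_row_def \<eta> simp del: cc_point_nth(3))
      also have "\<dots> = dcc_field \<alpha> m q \<eta> $ i $ c" unfolding F by (simp add: dcc_field_def)
      finally show ?thesis using row by simp
    qed
    have gauge: "\<eta> $ k $ 2 = 0" using row[of "Pos k 2"] by (simp add: dcc_row_def \<eta>)
    \<comment> \<open>All terms but the missing component vanish; its coefficient
      \<open>m k * q $ k $ 1\<close> is nonzero.\<close>
    have "0 = (\<Sum>i\<in>UNIV. m i * (dcc_field \<alpha> m q \<eta> $ i \<bullet> rot90 (q $ i)))"
      using dcc_field_inner_rot90[of \<alpha> m q \<eta>] q by (simp add: gauged_cc_def)
    also have "\<dots> = (\<Sum>i\<in>UNIV. if i = k then m k * (dcc_field \<alpha> m q \<eta> $ k $ 2 * q $ k $ 1) else 0)"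
      by (intro sum.cong refl) (auto simp: inner_real2 dcc)
    also have "\<dots> = m k * (dcc_field \<alpha> m q \<eta> $ k $ 2 * q $ k $ 1)" by simp
    finally have "dcc_field \<alpha> m q \<eta> $ k $ 2 = 0" using m q by (simp add: gauged_cc_def)
    with dcc have "dcc_field \<alpha> m q \<eta> = 0" by (metis vec_eq_iff zero_index)
    then obtain c where c: "\<And>i. \<eta> $ i = c *\<^sub>R rot90 (q $ i)" using q unfolding gauged_cc_def by blast
    have "c * q $ k $ 1 = 0" using gauge c[of k] by simp
    then have "c = 0" using q by (simp add: gauged_cc_def)
    then have \<eta>0: "\<eta> $ i = 0" for i using c by simp
    have hL: "h $ Lg i j = 0" for i j
      using L[of i j] row[of "Lg i j"] by (cases "i = j") (simp_all add: \<eta>0 dcc_row_def)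
    have hW: "h $ Wt i j = 0" for i j
      using W[of i j] row[of "Wt i j"] by (cases "i = j") (simp_all add: hL dcc_row_def)
    have hP: "h $ Pos i c = 0" for i c using \<eta> \<eta>0 by simp
    have rest: "h $ v = 0" if "v \<noteq> Slack" for v using that hL hW hP by (cases v) auto
    \<comment> \<open>Only the slack direction is left, and the sphere equation controls it because
      \<open>z\<close> is nonzero.\<close>
    have "?X \<bullet> h = (\<Sum>v\<in>UNIV. ?X $ v * h $ v)" by (simp add: inner_vec_def)
    also have "\<dots> = (\<Sum>v\<in>(UNIV :: 'n cvar set). if v = Slack then z * h $ Slack else 0)"
      by (intro sum.cong refl) (auto simp: rest)
    also have "\<dots> = z * h $ Slack" by simp
    finally have "h $ Slack = 0" using row[of Slack] z by (simp add: dcc_row_def)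
    with rest show "h = 0" by (metis vec_eq_iff zero_index)
  qed
  then have "inj ?D" using der has_derivative_linear linear_injective_0 by blast
  then show ?thesis using nondeg_iff[OF der] by simp
qed

text \<open>All points of a finite \<open>A\<close> are lifted to one sphere by individual slack
  values. Its radius depends on \<open>A\<close>, but the constant does not.\<close>

lemma card_gauged_cc_bound:
  "\<exists>C. \<forall>\<alpha> (m :: 'n::{finite,linorder} \<Rightarrow> real) k. \<alpha> \<ge> 0 \<longrightarrow> (\<forall>i. m i \<noteq> 0) \<longrightarrow>
     (\<forall>A. finite A \<longrightarrow> A \<subseteq> {q. gauged_cc \<alpha> m k q} \<longrightarrow> card A \<le> C)"
proof -
  obtain C where C: "\<forall>(P :: 'n cvar \<Rightarrow> real^'n cvar \<Rightarrow> real) b v y A.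
     (\<forall>i. polyd 2 (P i)) \<longrightarrow> b Slack = 0 \<longrightarrow> (\<forall>x. P Slack x = (norm x)\<^sup>2) \<longrightarrow>
     card {i. b i \<noteq> 0} = card {v :: 'n cvar. \<exists>i j. i \<noteq> j \<and> (v = Lg i j \<or> v = Wt i j)} \<longrightarrow>
     finite A \<longrightarrow> (\<forall>a\<in>A. exp_system P b v a = y \<and> nondeg (exp_system P b v) a) \<longrightarrow> card A \<le> C"
    using nondeg_solutions_bound by blast
  show ?thesis
  proof (intro exI[of _ C] allI impI)
    fix \<alpha> and m :: "'n \<Rightarrow> real" and k A
    assume \<alpha>: "\<alpha> \<ge> 0" and m: "\<forall>i. m i \<noteq> 0" and A: "finite A" "A \<subseteq> {q. gauged_cc \<alpha> m k q}"
    let ?N = "\<lambda>q. (norm (cc_point \<alpha> 0 q))\<^sup>2"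
    \<comment> \<open>The 1 makes every slack value strictly positive, as nondegeneracy of the
      lifted points requires.\<close>
    define R where "R = 1 + (\<Sum>q\<in>A. ?N q)"
    define z where "z q = sqrt (R - ?N q)" for q :: "'n config"
    have R: "?N q < R" if "q \<in> A" for q
    proof -
      have "?N q \<le> (\<Sum>q\<in>A. ?N q)" using A(1) that by (intro member_le_sum) auto
      then show ?thesis by (simp add: R_def)
    qed
    have N: "(norm (cc_point \<alpha> (z q) q))\<^sup>2 = R" if "q \<in> A" for q
    proof -
      have split: "(norm (cc_point \<alpha> w q))\<^sup>2 = w\<^sup>2 + (\<Sum>v\<in>UNIV - {Slack}. (cc_point \<alpha> w q $ v)\<^sup>2)" for w
        unfolding power2_norm_vec by (subst sum.remove[of _ Slack]) simp_all
      have "(\<Sum>v\<in>UNIV - {Slack}. (cc_point \<alpha> (z q) q $ v)\<^sup>2) = (\<Sum>v\<in>UNIV - {Slack}. (cc_point \<alpha> 0 q $ v)\<^sup>2)"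
        by (intro sum.cong refl) (auto simp: cc_point_def split: cvar.splits)
      then have "(norm (cc_point \<alpha> (z q) q))\<^sup>2 = (z q)\<^sup>2 + ?N q"
        using split[of "z q"] split[of 0] by simp
      then show ?thesis using R[OF that] by (simp add: z_def)
    qed
    let ?E = "\<lambda>q. cc_point \<alpha> (z q) q"
    let ?\<Phi> = "exp_system (cc_poly \<alpha> m k) (cc_rate \<alpha>) cc_arg"
    have "inj_on ?E A"
    proof (rule inj_onI)
      fix p q assume "?E p = ?E q"
      then have "?E p $ Pos i c = ?E q $ Pos i c" for i c by simp
      then show "p = q" by (simp add: vec_eq_iff)
    qed
    then have "card A = card (?E ` A)" by (simp add: card_image)
    also have "\<dots> \<le> C"
    proof (rule C[rule_format])
      show "polyd 2 (cc_poly \<alpha> m k v)" for v by (rule polyd_cc_poly)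
      show "cc_rate \<alpha> Slack = 0" "cc_poly \<alpha> m k Slack x = (norm x)\<^sup>2" for x
        by (simp_all add: cc_rate_def cc_poly_def)
      show "card {v :: 'n cvar. cc_rate \<alpha> v \<noteq> 0} = card {v :: 'n cvar. \<exists>i j. i \<noteq> j \<and> (v = Lg i j \<or> v = Wt i j)}"
        by (simp only: cc_rate_support[OF \<alpha>])
      show "finite (?E ` A)" using A(1) by simp
      fix x assume "x \<in> ?E ` A"
      then obtain q where q: "q \<in> A" "x = ?E q" by blast
      then have g: "gauged_cc \<alpha> m k q" using A(2) by blast
      have "z q \<noteq> 0" using R[OF q(1)] by (simp add: z_def)
      from nondeg_cc_point[OF g this] m
      show "?\<Phi> x = (\<chi> v. cc_rhs R v) \<and> nondeg ?\<Phi> x"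
        unfolding q(2) using cc_point_solves[OF g, of "z q"] N[OF q(1)] by simp
    qed
    finally show "card A \<le> C" .
  qed
qed

theorem theorem2p1:
  assumes "CARD('n::{finite,linorder}) \<ge> 3"
  shows "\<exists>l u :: real. \<forall>\<alpha>::real. \<forall>m :: 'n \<Rightarrow> real.
           \<alpha> \<ge> 0 \<longrightarrow> (\<forall>i. m i \<noteq> 0) \<longrightarrow> (\<Sum>i\<in>UNIV. m i) \<noteq> 0 \<longrightarrow>
             finite (nondegenerate_cc_classes \<alpha> m) \<and>
             l \<le> real (card (nondegenerate_cc_classes \<alpha> m)) \<and>
             real (card (nondegenerate_cc_classes \<alpha> m)) \<le> u"
proof -
  obtain C where C: "\<forall>\<alpha> (m :: 'n \<Rightarrow> real) k. \<alpha> \<ge> 0 \<longrightarrow> (\<forall>i. m i \<noteq> 0) \<longrightarrow>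
     (\<forall>A. finite A \<longrightarrow> A \<subseteq> {q. gauged_cc \<alpha> m k q} \<longrightarrow> card A \<le> C)"
    using card_gauged_cc_bound by blast
  show ?thesis
  \<comment> \<open>The lower bound is the trivial one; the upper bound adds \<open>C\<close> for
    each body that can serve as gauge.\<close>
  proof (rule exI[of _ 0], rule exI[of _ "real (CARD('n) * C)"], intro allI impI)
    fix \<alpha> :: real and m :: "'n \<Rightarrow> real"
    assume \<alpha>: "\<alpha> \<ge> 0" and m: "\<forall>i. m i \<noteq> 0"
    let ?S = "\<lambda>k. {q. gauged_cc \<alpha> m k q}"
    \<comment> \<open>A uniform bound on the finite subsets forces the whole set to be
      finite.\<close>
    have fin: "finite (?S k) \<and> card (?S k) \<le> C" for k
    proof (rule finite_if_finite_subsets_card_bdd)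
      show "\<And>A. A \<subseteq> ?S k \<Longrightarrow> finite A \<Longrightarrow> card A \<le> C" using C \<alpha> m by blast
    qed
    have sub: "nondegenerate_cc_classes \<alpha> m \<subseteq> (\<Union>k. O2_orbit ` ?S k)"
      using assms m by (intro nondegenerate_cc_classes_subset) auto
    have finU: "finite (\<Union>k. O2_orbit ` ?S k)" using fin by simp
    have "card (nondegenerate_cc_classes \<alpha> m) \<le> card (\<Union>k. O2_orbit ` ?S k)"
      by (rule card_mono[OF finU sub])
    also have "\<dots> \<le> (\<Sum>k\<in>UNIV. card (O2_orbit ` ?S k))" by (rule card_UN_le) simp
    also have "\<dots> \<le> (\<Sum>k\<in>(UNIV :: 'n set). C)"
    proof (rule sum_mono)
      show "card (O2_orbit ` ?S k) \<le> C" for k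
        using card_image_le[of "?S k" O2_orbit] fin[of k] by linarith
    qed
    finally have "card (nondegenerate_cc_classes \<alpha> m) \<le> CARD('n) * C" by simp
    then show "finite (nondegenerate_cc_classes \<alpha> m) \<and>
        0 \<le> real (card (nondegenerate_cc_classes \<alpha> m)) \<and>
        real (card (nondegenerate_cc_classes \<alpha> m)) \<le> real (CARD('n) * C)"
      using finite_subset[OF sub finU] by (simp only: of_nat_le_iff of_nat_0_le_iff simp_thms)
  qed
qed

end
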